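(* Let $p$ be a prime, let $G$ be a finite $p$-solvable group, and let $P$ be a Sylow $p$-subgroup of $G$. Suppose that there is a subgroup $H$ of $P$ with $P' \le H \le \Phi(P)$ such that $H$ is $s$-semipermutable in $G$. Suppose moreover that $N_G(P)$ is $p$-supersolvable. Then $G$ is $p$-supersolvable.
   Context: All groups are finite. $P'$ denotes the derived (commutator) subgroup of $P$ and $\Phi(P)$ its Frattini subgroup. A group is $p$-supersolvable if every chief factor of order divisible by $p$ is cyclic (of order $p$). A subgroup $H$ of $G$ is $s$-semipermutable in $G$ if $HQ = QH$ for every Sylow $q$-subgroup $Q$ of $G$ and every prime $q$ not dividing $|H|$. *)

theory Defs
  imports "HOL-Algebra.Algebra" "HOL-Computational_Algebra.Primes"
begin

definition sylow_subgroup :: "('a, 'b) monoid_scheme \<Rightarrow> nat \<Rightarrow> 'a set \<Rightarrow> bool" where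
  "sylow_subgroup G p P \<longleftrightarrow> subgroup P G \<and> card P = p ^ multiplicity p (order G)"

text \<open>Maximal subgroups and the Frattini subgroup (intersection of all maximal subgroups;
  equal to the whole group if there are none).\<close>
definition maximal_subgroup :: "'a set \<Rightarrow> ('a, 'b) monoid_scheme \<Rightarrow> bool" where
  "maximal_subgroup M G \<longleftrightarrow> subgroup M G \<and> M \<noteq> carrier G \<and>
     (\<forall>K. subgroup K G \<and> M \<subseteq> K \<longrightarrow> K = M \<or> K = carrier G)"

definition frattini :: "('a, 'b) monoid_scheme \<Rightarrow> 'a set" where
  "frattini G = carrier G \<inter> \<Inter>{M. maximal_subgroup M G}"

definition chief_factor :: "('a, 'b) monoid_scheme \<Rightarrow> 'a set \<Rightarrow> 'a set \<Rightarrow> bool" where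
  "chief_factor G H K \<longleftrightarrow> K \<lhd> G \<and> H \<lhd> G \<and> K \<subset> H \<and>
     (\<forall>N. N \<lhd> G \<and> K \<subseteq> N \<and> N \<subseteq> H \<longrightarrow> N = K \<or> N = H)"

definition p_solvable :: "nat \<Rightarrow> ('a, 'b) monoid_scheme \<Rightarrow> bool" where
  "p_solvable p G \<longleftrightarrow> (\<forall>H K. chief_factor G H K \<longrightarrow>
      (\<exists>n. card H = p ^ n * card K) \<or> \<not> p dvd (card H div card K))"

definition p_supersolvable :: "nat \<Rightarrow> ('a, 'b) monoid_scheme \<Rightarrow> bool" where
  "p_supersolvable p G \<longleftrightarrow> (\<forall>H K. chief_factor G H K \<longrightarrow>
      p dvd (card H div card K) \<longrightarrow> card H = p * card K)"

definition s_semipermutable :: "'a set \<Rightarrow> ('a, 'b) monoid_scheme \<Rightarrow> bool" where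
  "s_semipermutable H G \<longleftrightarrow> subgroup H G \<and> (\<forall>q Q. Factorial_Ring.prime (q::nat) \<and> \<not> q dvd card H \<and> sylow_subgroup G q Q \<longrightarrow>
      H <#>\<^bsub>G\<^esub> Q = Q <#>\<^bsub>G\<^esub> H)"

end

(* Let M be a maximal normal p'-subgroup, N/M the largest normal p-subgroup of G/M, and
   K = MH \<inter> N. Modulo M, H is a Sylow p-subgroup of HQ for every Sylow q-subgroup Q with
   q \<noteq> p, so Q normalizes K; so does P, because P' \<le> H. Hence K is normal in G, and
   [N,P] \<le> K. Let C be the centralizer of N/K; it contains P. If C were not contained in N,
   there would be a chief factor L/N with L \<le> C, necessarily of p'-order. A complement of N/K
   in L/K is normal in G since N/K is central there. It can be pushed further down along the
   derived series of K: a complement in an abelian section D/E is unique up to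
   D-conjugacy, so G = D N(W), and D is contained in M \<Phi>(P), so P normalizes W and W is normal
   in G. At the bottom this contradicts the choice of M. So C = N, i.e. MP = N is normal in G,
   and G = M N(P) by the Frattini argument; chief factors of G of order divisible by p
   are therefore chief factors of N(P). *)
theory Submission
  imports Defs
begin

subsection \<open>Counting fixed points of p-groups\<close>

context group
begin

text \<open>The goal C \<le> N resembles the Hall-Higman lemma on centralizers, but there is an
  obstacle: K/M is only known to lie in the Frattini subgroup of a Sylow p-subgroup of G/M, whereas
  the usual coprime-action argument wants the Frattini subgroup of N/M. Complements get around this.
  If G moves a complement W of D/E only by conjugations from D, then P is generated by its part
  normalizing W together with P \<inter> D, and P \<inter> D consists of nongenerators of P. So the
  essential property of the complement is its uniqueness up to conjugacy rather than its existence.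
  For abelian sections both come from one averaging over cosets, which is why the descent takes
  abelian steps instead of splitting off K/M at once. Most work modulo M is done inside G, with
  subgroups that contain M; the p-part of such a subgroup is read off by intersecting it with
  P.\<close>

lemma inv_mult_cancel_left:
  "x \<in> carrier G \<Longrightarrow> z \<in> carrier G \<Longrightarrow> inv x \<otimes> (x \<otimes> z) = z"
  "x \<in> carrier G \<Longrightarrow> z \<in> carrier G \<Longrightarrow> x \<otimes> (inv x \<otimes> z) = z"
  by (simp_all add: m_assoc[symmetric])

text \<open>As rewrite rules these bring a word into right-nested reduced form; most commutator and
  conjugation identities below are checked this way.\<close>

lemmas group_normalize = m_assoc inv_mult_group inv_mult_cancel_left

lemma rcos_eq_iff:
  assumes "subgroup A G" "u \<in> carrier G" "v \<in> carrier G"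
  shows "A #> u = A #> v \<longleftrightarrow> u \<otimes> inv v \<in> A"
  using assms
  by (metis is_group rcos_self repr_independence subgroup.rcos_module)

lemma card_subgroup_dvd:
  assumes "subgroup A G" "subgroup B G" "A \<subseteq> B"
  shows "card A dvd card B"
proof -
  have "subgroup A (G\<lparr>carrier := B\<rparr>)"
    using subgroup_incl assms by blast
  from group.lagrange[OF subgroup_imp_group[OF assms(2)] this]
  have "card (rcosets\<^bsub>G\<lparr>carrier := B\<rparr>\<^esub> A) * card A = card B"
    by (simp add: order_def)
  then show ?thesis by (metis dvd_triv_right)
qed

text \<open>\<open>A <#> B\<close> need not be a subgroup, so Lagrange's theorem does not apply to
  it. The fibre of (u, v) \<mapsto> uv over y is instead parametrized by the z in A \<inter> B,
  starting from one chosen factorization \<open>a y \<otimes> b y\<close>.\<close>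

lemma card_set_mult:
  assumes A: "subgroup A G" and B: "subgroup B G"
  shows "card (A <#> B) * card (A \<inter> B) = card A * card B"
proof -
  define a where "a y = (SOME a. a \<in> A \<and> (\<exists>b\<in>B. y = a \<otimes> b))" for y
  have a: "a y \<in> A \<and> (\<exists>b\<in>B. y = a y \<otimes> b)" if "y \<in> A <#> B" for y
    unfolding a_def by (rule someI_ex) (use that in \<open>auto simp: set_mult_def\<close>)
  define b where "b y = inv (a y) \<otimes> y" for y
  note Ac = subgroup.mem_carrier[OF A] and Bc = subgroup.mem_carrier[OF B]
  note Aclosed = subgroup.m_closed[OF A] subgroup.m_inv_closed[OF A]
  note Bclosed = subgroup.m_closed[OF B] subgroup.m_inv_closed[OF B]
  have b: "b y \<in> B" "y = a y \<otimes> b y" if y: "y \<in> A <#> B" for y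
  proof -
    obtain b' where b': "b' \<in> B" "y = a y \<otimes> b'" using a[OF y] by blast
    have "b y = inv (a y) \<otimes> (a y \<otimes> b')" unfolding b_def using b'(2) by simp
    then have "b y = b'" using a[OF y] b'(1) Ac Bc by (simp add: inv_mult_cancel_left)
    then show "b y \<in> B" "y = a y \<otimes> b y" using b' by auto
  qed
  have "bij_betw (\<lambda>(y, z). (a y \<otimes> z, inv z \<otimes> b y)) ((A <#> B) \<times> (A \<inter> B)) (A \<times> B)"
  proof (rule bij_betwI[where g = "\<lambda>(u, v). (u \<otimes> v, inv (a (u \<otimes> v)) \<otimes> u)"])
    show "(\<lambda>(y, z). (a y \<otimes> z, inv z \<otimes> b y)) \<in> (A <#> B) \<times> (A \<inter> B) \<rightarrow> A \<times> B"
      using a b Aclosed Bclosed by auto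
    have uv: "u \<otimes> v \<in> A <#> B" if "u \<in> A" "v \<in> B" for u v
      using that by (auto simp: set_mult_def)
    have eq: "inv (a (u \<otimes> v)) \<otimes> u = b (u \<otimes> v) \<otimes> inv v" if "u \<in> A" "v \<in> B" for u v
      using that a[OF uv[OF that]] Ac Bc by (simp add: b_def m_assoc)
    show "(\<lambda>(u, v). (u \<otimes> v, inv (a (u \<otimes> v)) \<otimes> u)) \<in> A \<times> B \<rightarrow> (A <#> B) \<times> (A \<inter> B)"
    proof (clarsimp, intro conjI)
      fix u v assume u: "u \<in> A" and v: "v \<in> B"
      show "u \<otimes> v \<in> A <#> B" by (rule uv[OF u v])
      show "inv (a (u \<otimes> v)) \<otimes> u \<in> A" using a[OF uv[OF u v]] u Aclosed by blast
      show "inv (a (u \<otimes> v)) \<otimes> u \<in> B"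
        using eq[OF u v] b(1)[OF uv[OF u v]] v Bclosed by simp
    qed
    fix x assume "x \<in> (A <#> B) \<times> (A \<inter> B)"
    then obtain y z where x: "x = (y, z)" and y: "y \<in> A <#> B" and z: "z \<in> A" "z \<in> B" by auto
    have c: "a y \<in> carrier G" "b y \<in> carrier G" "z \<in> carrier G"
      using a[OF y] b[OF y] z Ac Bc by auto
    have "a y \<otimes> z \<otimes> (inv z \<otimes> b y) = a y \<otimes> b y"
      using c by (simp add: group_normalize)
    then have "a y \<otimes> z \<otimes> (inv z \<otimes> b y) = y" using b(2)[OF y] by simp
    then show "(case case x of (y, z) \<Rightarrow> (a y \<otimes> z, inv z \<otimes> b y) of
        (u, v) \<Rightarrow> (u \<otimes> v, inv (a (u \<otimes> v)) \<otimes> u)) = x"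
      using c by (simp add: x m_assoc[symmetric])
  next
    fix x assume "x \<in> A \<times> B"
    then obtain u v where x: "x = (u, v)" and u: "u \<in> A" and v: "v \<in> B" by auto
    have uv: "u \<otimes> v \<in> A <#> B" using u v by (auto simp: set_mult_def)
    have c: "a (u \<otimes> v) \<in> carrier G" "u \<in> carrier G" "v \<in> carrier G"
      using a[OF uv] u v Ac Bc by auto
    show "(case case x of (u, v) \<Rightarrow> (u \<otimes> v, inv (a (u \<otimes> v)) \<otimes> u) of
        (y, z) \<Rightarrow> (a y \<otimes> z, inv z \<otimes> b y)) = x"
      using c by (simp add: x b_def inv_mult_group m_assoc)
       (simp add: m_assoc[symmetric])
  qed
  then show ?thesis
    by (auto dest: bij_betw_same_card simp: card_cartesian_product)
qed

end

text \<open>An orbit with more than one point has p^k points with k > 0. Counting moved points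
  serves two uses: a fixed point exists if p does not divide |E|, and the number of fixed points is
  divisible by p if |E| is.\<close>

lemma (in group_action) prime_dvd_card_moved_points:
  assumes fin: "finite E" and p: "Factorial_Ring.prime p" and ord: "order G = p ^ n"
  shows "p dvd card (E - {x \<in> E. \<forall>g\<in>carrier G. \<phi> g x = x})"
proof -
  let ?F = "{x \<in> E. \<forall>g\<in>carrier G. \<phi> g x = x}"
  let ?C = "(\<lambda>x. orbit G \<phi> x) ` (E - ?F)"
  have orbE: "orbit G \<phi> x \<subseteq> E" if "x \<in> E" for x
    using that element_image by (auto simp: orbit_def)
  have orbF: "orbit G \<phi> x \<inter> ?F = {}" if "x \<in> E" "x \<notin> ?F" for x
  proof -
    have False if "y \<in> orbit G \<phi> x" "y \<in> ?F" for y
    proof -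
      have "x \<in> orbit G \<phi> y"
        using orbit_sym \<open>x \<in> E\<close> that by auto
      then show False
        using that \<open>x \<notin> ?F\<close> by (auto simp: orbit_def)
    qed
    then show ?thesis by blast
  qed
  have un: "\<Union>?C = E - ?F"
    using orbE orbF orbit_refl by blast
  have "p dvd card (\<Union>?C)"
  proof (rule dvd_partition)
    show "finite (\<Union>?C)" unfolding un using fin by simp
    show "\<forall>c\<in>?C. p dvd card c"
    proof
      fix c assume "c \<in> ?C"
      then obtain x g where c: "c = orbit G \<phi> x" and x: "x \<in> E" and g: "g \<in> carrier G"
        and gx: "\<phi> g x \<noteq> x" by blast
      have "card (orbit G \<phi> x) dvd p ^ n"
        using orbit_stabilizer_theorem[OF x] ord by (metis dvd_triv_left mult.commute)
      then obtain k where k: "card (orbit G \<phi> x) = p ^ k"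
        using p divides_primepow_nat by blast
      have "k \<noteq> 0"
      proof
        assume "k = 0"
        then have "card (orbit G \<phi> x) = 1" using k by simp
        moreover have "x \<in> orbit G \<phi> x" "\<phi> g x \<in> orbit G \<phi> x"
          using orbit_refl x g by (auto simp: orbit_def)
        ultimately show False using gx by (metis card_1_singletonE singletonD)
      qed
      then show "p dvd card c" using k c by simp
    qed
    show "\<forall>c1\<in>?C. \<forall>c2\<in>?C. c1 \<noteq> c2 \<longrightarrow> c1 \<inter> c2 = {}"
    proof (intro ballI impI)
      fix c1 c2 assume "c1 \<in> ?C" "c2 \<in> ?C" "c1 \<noteq> c2"
      moreover have "?C \<subseteq> orbits G E \<phi>" by (auto simp: orbits_def)
      ultimately show "c1 \<inter> c2 = {}" using disjoint_union by (meson subsetD)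
    qed
  qed
  then show ?thesis unfolding un .
qed

context group
begin

text \<open>Right multiplication becomes a left action only after inverting q, and
  \<open>BijGroup\<close> consists of functions that are undefined outside the set, hence the
  restricted abstraction.\<close>

lemma rcosets_action:
  assumes Q: "subgroup Q G" and P: "subgroup P G"
  shows "group_action (G\<lparr>carrier := Q\<rparr>) (rcosets P) (\<lambda>q. \<lambda>c\<in>rcosets P. c #> inv q)"
proof -
  have cl: "c #> q \<in> rcosets P" if "c \<in> rcosets P" "q \<in> carrier G" for c q
    using that subgroup.subset[OF P] by (auto simp: RCOSETS_def coset_mult_assoc)
  have sub: "c \<subseteq> carrier G" if "c \<in> rcosets P" for c
    using that subgroup.rcosets_carrier[OF P is_group] by blast
  have bij: "(\<lambda>c\<in>rcosets P. c #> inv q) \<in> Bij (rcosets P)" if "q \<in> Q" for q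
  proof -
    have q: "q \<in> carrier G" using that subgroup.mem_carrier[OF Q] by blast
    have "bij_betw (\<lambda>c\<in>rcosets P. c #> inv q) (rcosets P) (rcosets P)"
      by (rule bij_betwI[where g = "\<lambda>c. c #> q"])
        (use q cl sub in \<open>auto simp: coset_mult_assoc\<close>)
    then show ?thesis by (simp add: Bij_def)
  qed
  show ?thesis
    unfolding group_action_def group_hom_def group_hom_axioms_def
  proof (intro conjI)
    show "group (G\<lparr>carrier := Q\<rparr>)" by (rule subgroup_imp_group[OF Q])
    show "group (BijGroup (rcosets P))" by (rule group_BijGroup)
    show "(\<lambda>q. \<lambda>c\<in>rcosets P. c #> inv q) \<in> hom (G\<lparr>carrier := Q\<rparr>) (BijGroup (rcosets P))"
    proof (rule homI)
      fix x assume "x \<in> carrier (G\<lparr>carrier := Q\<rparr>)"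
      then show "(\<lambda>c\<in>rcosets P. c #> inv x) \<in> carrier (BijGroup (rcosets P))"
        using bij by (simp add: BijGroup_def)
    next
      fix x y assume "x \<in> carrier (G\<lparr>carrier := Q\<rparr>)" "y \<in> carrier (G\<lparr>carrier := Q\<rparr>)"
      then have xy: "x \<in> Q" "y \<in> Q" by auto
      then have xc: "x \<in> carrier G" "y \<in> carrier G" using subgroup.mem_carrier[OF Q] by auto
      show "(\<lambda>c\<in>rcosets P. c #> inv (x \<otimes>\<^bsub>G\<lparr>carrier := Q\<rparr>\<^esub> y)) =
        (\<lambda>c\<in>rcosets P. c #> inv x) \<otimes>\<^bsub>BijGroup (rcosets P)\<^esub> (\<lambda>c\<in>rcosets P. c #> inv y)"
        using bij xy xc sub cl
        by (auto simp: BijGroup_def compose_def restrict_def fun_eq_iff inv_mult_group coset_mult_assoc)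
    qed
  qed
qed

lemma prime_dvd_card_moved_rcosets:
  assumes fin: "finite (carrier G)" and p: "Factorial_Ring.prime p"
    and Q: "subgroup Q G" "card Q = p ^ n" and P: "subgroup P G"
  shows "p dvd card (rcosets P - {c \<in> rcosets P. \<forall>q\<in>Q. c #> inv q = c})"
proof -
  interpret group_action "G\<lparr>carrier := Q\<rparr>" "rcosets P" "\<lambda>q. \<lambda>c\<in>rcosets P. c #> inv q"
    by (rule rcosets_action[OF Q(1) P])
  have "finite (rcosets P)"
    using fin rcosets_subset_PowG[OF P] by (meson finite_Pow_iff finite_subset)
  from prime_dvd_card_moved_points[OF this p, of n]
  have "p dvd card (rcosets P - {c \<in> rcosets P. \<forall>q\<in>Q. (\<lambda>c\<in>rcosets P. c #> inv q) c = c})"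
    using Q(2) by (simp add: order_def)
  moreover have "{c \<in> rcosets P. \<forall>q\<in>Q. (\<lambda>c\<in>rcosets P. c #> inv q) c = c} =
    {c \<in> rcosets P. \<forall>q\<in>Q. c #> inv q = c}" by auto
  ultimately show ?thesis by simp
qed

lemma rcoset_fixed_iff:
  assumes P: "subgroup P G" and g: "g \<in> carrier G" and q: "q \<in> carrier G"
  shows "(P #> g) #> inv q = P #> g \<longleftrightarrow> g \<otimes> q \<otimes> inv g \<in> P"
proof -
  have "(P #> g) #> inv q = P #> (g \<otimes> inv q)"
    using g q subgroup.subset[OF P] by (simp add: coset_mult_assoc)
  moreover have "P #> (g \<otimes> inv q) = P #> g \<longleftrightarrow> g \<in> P #> (g \<otimes> inv q)"
    using g q repr_independence[OF _ _ P, of g "g \<otimes> inv q"] rcos_self[OF _ P, of g]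
    by auto
  moreover have "\<dots> \<longleftrightarrow> g \<otimes> inv (g \<otimes> inv q) \<in> P"
    using subgroup.rcos_module[OF P is_group, of "g \<otimes> inv q" g] g q by simp
  moreover have "g \<otimes> inv (g \<otimes> inv q) = g \<otimes> q \<otimes> inv g"
    using g q by (simp add: inv_mult_group m_assoc)
  ultimately show ?thesis by simp
qed

text \<open>The number of cosets of P moved by Q is divisible by p and the number of all cosets is
  not, so Q fixes some coset P g; this means that g Q g^-1 lies in P.\<close>

lemma p_subgroup_conj_in:
  assumes fin: "finite (carrier G)" and p: "Factorial_Ring.prime p"
    and Q: "subgroup Q G" "card Q = p ^ n" and P: "subgroup P G"
    and idx: "\<not> p dvd card (rcosets P)"
  obtains g where "g \<in> carrier G" "\<And>q. q \<in> Q \<Longrightarrow> g \<otimes> q \<otimes> inv g \<in> P"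
proof -
  let ?F = "{c \<in> rcosets P. \<forall>q\<in>Q. c #> inv q = c}"
  have "?F \<noteq> {}"
    using prime_dvd_card_moved_rcosets[OF fin p Q P] idx by (metis Diff_empty)
  then obtain c where c: "c \<in> rcosets P" "\<forall>q\<in>Q. c #> inv q = c" by blast
  then obtain g where g: "g \<in> carrier G" "c = P #> g" by (auto simp: RCOSETS_def)
  show thesis
  proof (rule that[OF g(1)])
    fix q assume "q \<in> Q"
    then show "g \<otimes> q \<otimes> inv g \<in> P"
      using c(2) g rcoset_fixed_iff[OF P g(1)] subgroup.mem_carrier[OF Q(1)] by simp
  qed
qed

text \<open>M acts on its own cosets. Since p divides the index, it divides the number of fixed
  cosets; M itself is fixed, so there is another fixed coset M g, and then g normalizes M without
  lying in M.\<close>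

lemma p_group_normalizer_grows:
  assumes fin: "finite (carrier G)" and p: "Factorial_Ring.prime p"
    and ord: "order G = p ^ n" and M: "subgroup M G" "M \<noteq> carrier G"
  obtains g where "g \<in> carrier G" "g \<notin> M" "\<And>x. x \<in> M \<Longrightarrow> g \<otimes> x \<otimes> inv g \<in> M"
proof -
  let ?F = "{c \<in> rcosets M. \<forall>q\<in>M. c #> inv q = c}"
  have lag: "card (rcosets M) * card M = p ^ n"
    using lagrange[OF M(1)] ord by simp
  obtain m where m: "card M = p ^ m"
    using lag p divides_primepow_nat by (metis dvd_triv_right)
  obtain k where k: "card (rcosets M) = p ^ k"
    using lag p divides_primepow_nat by (metis dvd_triv_left)
  have "card M < order G"
    unfolding order_def using fin M subgroup.subset[OF M(1)] by (meson psubset_card_mono psubsetI)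
  then have "k \<noteq> 0" using lag k ord by (intro notI) simp
  then have pd: "p dvd card (rcosets M)" using k by simp
  have finr: "finite (rcosets M)"
    using fin rcosets_subset_PowG[OF M(1)] by (meson finite_Pow_iff finite_subset)
  have "card (rcosets M) = card (rcosets M - ?F) + card ?F"
  proof -
    have "?F \<subseteq> rcosets M" by blast
    then show ?thesis
      using finr card_mono[OF finr, of ?F] card_Diff_subset[of ?F "rcosets M"] finite_subset by fastforce
  qed
  then have "p dvd card ?F"
    using pd prime_dvd_card_moved_rcosets[OF fin p M(1) m M(1)] by (simp add: dvd_add_right_iff)
  moreover have "M #> \<one> = M" using subgroup.subset[OF M(1)] by simp
  then have MF: "M \<in> ?F"
    using rcoset_fixed_iff[OF M(1), of \<one>] subgroup.mem_carrier[OF M(1)] rcosetsI[OF subgroup.subset[OF M(1)], of \<one>] by simp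
  ultimately have "?F \<noteq> {M}"
    using p by (auto simp: prime_nat_iff)
  then obtain c where c: "c \<in> ?F" "c \<noteq> M" using MF by blast
  then obtain g where g: "g \<in> carrier G" "c = M #> g" by (auto simp: RCOSETS_def)
  have "g \<notin> M" using c g coset_join2[OF _ M(1)] by auto
  show thesis
  proof (rule that[OF g(1) \<open>g \<notin> M\<close>])
    fix x assume "x \<in> M"
    then show "g \<otimes> x \<otimes> inv g \<in> M"
      using c(1) g rcoset_fixed_iff[OF M(1) g(1)] subgroup.mem_carrier[OF M(1)] by simp
  qed
qed

end

subsection \<open>Complements in abelian normal sections\<close>

lemma (in comm_group) hom_finprod_comm:
  assumes H: "comm_group H" and h: "h \<in> hom G H" and f: "f \<in> C \<rightarrow> carrier G"
  shows "h (finprod G f C) = finprod H (\<lambda>c. h (f c)) C"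
proof -
  interpret H: comm_group H by (rule H)
  interpret h: group_hom G H h by unfold_locales (rule h)
  show ?thesis using f
    by (induction C rule: infinite_finite_induct) (auto simp: Pi_iff)
qed

context group
begin

text \<open>For a transversal \<open>s\<close> of \<open>A\<close> in \<open>V\<close>, the product of the \<open>x s(c) s(xc)\<^sup>-\<^sup>1\<close> over the cosets \<open>c\<close> is a crossed
  homomorphism \<open>V \<rightarrow> A\<close> that is bijective on \<open>A\<close>; its kernel is the complement. Changing \<open>s\<close> changes the
  kernel by an \<open>A\<close>-conjugation, and conjugating by \<open>g \<in> G\<close> amounts to a change of \<open>s\<close>.\<close>

theorem abelian_normal_complement:
  assumes fin: "finite (carrier G)"
    and A: "A \<lhd> G" and V: "V \<lhd> G" and AV: "A \<subseteq> V"
    and comm: "\<And>a b. a \<in> A \<Longrightarrow> b \<in> A \<Longrightarrow> a \<otimes> b = b \<otimes> a"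
    and cop: "coprime (card A) (card V div card A)"
  obtains T where "subgroup T G" "T \<subseteq> V" "A \<inter> T = {\<one>}" "V \<subseteq> A <#> T"
    "\<And>g. g \<in> carrier G \<Longrightarrow> \<exists>a\<in>A. \<forall>t\<in>T. (a \<otimes> g) \<otimes> t \<otimes> inv (a \<otimes> g) \<in> T"
proof -
  interpret A: normal A G by (rule A)
  interpret V: normal V G by (rule V)
  define AA where "AA = G\<lparr>carrier := A\<rparr>"
  have AA [simp]: "carrier AA = A" "(\<otimes>\<^bsub>AA\<^esub>) = (\<otimes>)" "\<one>\<^bsub>AA\<^esub> = \<one>"
    by (simp_all add: AA_def)
  have gAA: "group AA" unfolding AA_def by (rule subgroup_imp_group[OF A.subgroup_axioms])
  interpret AA: comm_group AA
    by (rule group.group_comm_groupI[OF gAA]) (simp add: comm)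
  have Ac: "a \<in> carrier G" if "a \<in> A" for a using that by simp
  have Vc: "a \<in> carrier G" if "a \<in> V" for a using that by simp
  have conjA: "g \<otimes> a \<otimes> inv g \<in> A" if "g \<in> carrier G" "a \<in> A" for g a
    using that by (rule A.inv_op_closed2)
  have conjV: "g \<otimes> a \<otimes> inv g \<in> V" if "g \<in> carrier G" "a \<in> V" for g a
    using that by (rule V.inv_op_closed2)
  define K where "K u = A #> u" for u
  have Keq: "K u = K v \<longleftrightarrow> u \<otimes> inv v \<in> A" if "u \<in> carrier G" "v \<in> carrier G" for u v
    unfolding K_def using that by (rule rcos_eq_iff[OF A.subgroup_axioms])
  have Kmult: "K (x \<otimes> u) = K (x \<otimes> v)"
    if "K u = K v" "x \<in> carrier G" "u \<in> carrier G" "v \<in> carrier G" for x u v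
  proof -
    have "x \<otimes> (u \<otimes> inv v) \<otimes> inv x \<in> A" using that Keq conjA by blast
    moreover have "x \<otimes> u \<otimes> inv (x \<otimes> v) = x \<otimes> (u \<otimes> inv v) \<otimes> inv x"
      using that by (simp add: group_normalize)
    ultimately show ?thesis using that by (simp add: Keq)
  qed
  have Kmultr: "K (u \<otimes> x) = K (v \<otimes> x)"
    if "K u = K v" "x \<in> carrier G" "u \<in> carrier G" "v \<in> carrier G" for x u v
    using that by (simp add: Keq group_normalize)
  define C where "C = K ` V"
  have finC: "finite C"
    unfolding C_def using fin V.subset by (meson finite_imageI finite_subset)
  define r where "r c = (SOME u. u \<in> V \<and> K u = c)" for c
  have r: "r c \<in> V" "K (r c) = c" if "c \<in> C" for c
    using that someI_ex[of "\<lambda>u. u \<in> V \<and> K u = c"] unfolding C_def r_def by blast+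
  \<comment> \<open>Because A is normal, V permutes the cosets A u also by multiplication on the
    left.\<close>
  define act where "act x c = K (x \<otimes> r c)" for x c
  have actC: "act x c \<in> C" if "x \<in> V" "c \<in> C" for x c
    using that r unfolding act_def C_def by blast
  have act_K: "act x (K u) = K (x \<otimes> u)" if "x \<in> V" "u \<in> V" for x u
    unfolding act_def using that r[of "K u"] Vc by (intro Kmult) (auto simp: C_def)
  have act_act: "act x (act y c) = act (x \<otimes> y) c" if "x \<in> V" "y \<in> V" "c \<in> C" for x y c
    using that r[of c] act_K[of x "y \<otimes> r c"] by (simp add: act_def m_assoc)
  have act_one: "act \<one> c = c" if "c \<in> C" for c
    using that r[of c] by (simp add: act_def)
  have act_A: "act a c = c" if "a \<in> A" "c \<in> C" for a c
  proof -
    have "K (a \<otimes> r c) = K (r c)" 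
      using Keq[of "a \<otimes> r c" "r c"] that r(1)[OF that(2)] by (simp add: group_normalize)
    then show ?thesis using r that by (simp add: act_def)
  qed
  have act_inj: "inj_on (act x) C" if "x \<in> V" for x
  proof (rule inj_on_inverseI[where g = "act (inv x)"])
    fix c assume "c \<in> C"
    then show "act (inv x) (act x c) = c" using that act_one by (simp add: act_act)
  qed
  have act_img: "act x ` C = C" if "x \<in> V" for x
    using that actC act_inj finC by (intro endo_inj_surj) auto
  define trans where "trans s \<longleftrightarrow> (\<forall>c\<in>C. s c \<in> V \<and> K (s c) = c)" for s
  define f where "f s x c = x \<otimes> s c \<otimes> inv (s (act x c))" for s x c
  have fA: "f s x c \<in> A" if "trans s" "x \<in> V" "c \<in> C" for s x c
  proof -
    have "s c \<in> V" "K (s c) = c" "s (act x c) \<in> V" "K (s (act x c)) = act x c"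
      using that actC unfolding trans_def by auto
    then have "K (x \<otimes> s c) = K (s (act x c))"
      using act_K[of x "s c"] that by simp
    then show ?thesis
      unfolding f_def using \<open>s c \<in> V\<close> \<open>s (act x c) \<in> V\<close> that by (subst (asm) Keq) auto
  qed
  define \<phi> where "\<phi> s x = finprod AA (f s x) C" for s x
  have \<phi>A: "\<phi> s x \<in> A" if "trans s" "x \<in> V" for s x
    unfolding \<phi>_def using fA that AA.finprod_closed[of "f s x" C] by auto
  have conj_finprod: "g \<otimes> finprod AA h C \<otimes> inv g = finprod AA (\<lambda>c. g \<otimes> h c \<otimes> inv g) C"
    if "g \<in> carrier G" "\<And>c. c \<in> C \<Longrightarrow> h c \<in> A" for g h
  proof (rule AA.hom_finprod_comm[OF AA.comm_group_axioms])
    show "(\<lambda>x. g \<otimes> x \<otimes> inv g) \<in> hom AA AA"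
      using that conjA by (auto intro!: homI simp: group_normalize)
    show "h \<in> C \<rightarrow> carrier AA" using that by auto
  qed
  have mult_finprod: "finprod AA h C \<otimes> finprod AA k C = finprod AA (\<lambda>c. h c \<otimes> k c) C"
    if "\<And>c. c \<in> C \<Longrightarrow> h c \<in> A" "\<And>c. c \<in> C \<Longrightarrow> k c \<in> A" for h k
    using AA.finprod_multf[of h C k] that by (simp add: Pi_iff)
  have reindex: "finprod AA h C = finprod AA (\<lambda>c. h (j c)) C"
    if "inj_on j C" "j ` C = C" "\<And>c. c \<in> C \<Longrightarrow> h c \<in> A" for h j
    using AA.finprod_reindex[of h j C] that by (simp add: Pi_iff)
  have cong: "finprod AA h C = finprod AA k C"
    if "\<And>c. c \<in> C \<Longrightarrow> h c = k c" "\<And>c. c \<in> C \<Longrightarrow> k c \<in> A" for h k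
    by (rule AA.finprod_cong') (use that in auto)
  have tr: "trans r" using r by (simp add: trans_def)
  have cocycle: "\<phi> s (x \<otimes> y) = (x \<otimes> \<phi> s y \<otimes> inv x) \<otimes> \<phi> s x"
    if s: "trans s" and x: "x \<in> V" and y: "y \<in> V" for s x y
  proof -
    \<comment> \<open>Shifting the index of the second product from c to yc lets the factors
      telescope: x (y s(c) s(yc)^-1) x^-1 times x s(yc) s(xyc)^-1 is xy s(c) s(xyc)^-1.\<close>
    have "(x \<otimes> \<phi> s y \<otimes> inv x) \<otimes> \<phi> s x =
      finprod AA (\<lambda>c. x \<otimes> f s y c \<otimes> inv x) C \<otimes> finprod AA (\<lambda>c. f s x (act y c)) C"
      unfolding \<phi>_def using s x y fA
      by (subst conj_finprod, simp_all, subst reindex[OF act_inj act_img, of y], simp_all)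
    also have "\<dots> = finprod AA (\<lambda>c. (x \<otimes> f s y c \<otimes> inv x) \<otimes> f s x (act y c)) C"
      using s x y fA conjA actC by (intro mult_finprod) auto
    also have "\<dots> = \<phi> s (x \<otimes> y)"
      unfolding \<phi>_def
    proof (rule cong)
      fix c assume c: "c \<in> C"
      have "s c \<in> V" "s (act y c) \<in> V" "s (act x (act y c)) \<in> V"
        using s c x y actC by (auto simp: trans_def)
      then show "(x \<otimes> f s y c \<otimes> inv x) \<otimes> f s x (act y c) = f s (x \<otimes> y) c"
        unfolding f_def using x y c by (simp add: group_normalize act_act)
      show "f s (x \<otimes> y) c \<in> A" using s x y c fA by simp
    qed
    finally show ?thesis by simp
  qed
  define n where "n = card C"
  \<comment> \<open>Elements of A fix every coset, so each of the n factors equals a. As n is prime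
    to |A|, this power map is a bijection of A.\<close>
  have \<phi>_on_A: "\<phi> r a = a [^] n" if a: "a \<in> A" for a
  proof -
    have "\<phi> r a = finprod AA (\<lambda>c. a) C"
      unfolding \<phi>_def
    proof (rule cong)
      fix c assume "c \<in> C"
      then show "f r a c = a"
        using a r[of c] by (simp add: f_def act_A m_assoc)
    qed (use a in auto)
    also have "\<dots> = a [^]\<^bsub>AA\<^esub> n"
      unfolding n_def by (rule AA.finprod_const) (use a in auto)
    also have "\<dots> = a [^] n" unfolding AA_def by (metis nat_pow_consistent)
    finally show ?thesis .
  qed
  have "C = rcosets\<^bsub>G\<lparr>carrier := V\<rparr>\<^esub> A"
    by (auto simp: C_def K_def RCOSETS_def r_coset_def)
  moreover have "card (rcosets\<^bsub>G\<lparr>carrier := V\<rparr>\<^esub> A) * card A = card V"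
    using group.lagrange[OF subgroup_imp_group[OF V.subgroup_axioms],
        OF subgroup_incl[OF A.subgroup_axioms V.subgroup_axioms AV]]
    by (simp add: order_def)
  ultimately have nA: "n * card A = card V" unfolding n_def by simp
  have cA: "card A \<noteq> 0"
    using fin A.subset A.one_closed by (metis card_eq_0_iff empty_iff finite_subset)
  then have "card V div card A = n" using nA by (metis nonzero_mult_div_cancel_right)
  then have gcd: "gcd n (card A) = 1" using cop by (metis coprime_iff_gcd_eq_1 gcd.commute)
  have n0: "n \<noteq> 0" using nA V.one_closed fin V.subset
    by (metis card_eq_0_iff empty_iff finite_subset mult_is_0)
  \<comment> \<open>The k-th power inverts the n-th power on A, since a^|A| = 1.\<close>
  obtain k y where ky: "n * k = card A * y + 1" using bezout_nat[OF n0, of "card A"] gcd by auto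
  have root: "a [^] (n * k) = a" if a: "a \<in> A" for a
  proof -
    have "a [^]\<^bsub>AA\<^esub> card A = \<one>"
      using AA.pow_order_eq_1[of a] a by (simp add: order_def)
    then have "a [^] card A = \<one>" unfolding AA_def by (metis nat_pow_consistent)
    then show ?thesis
      using a by (simp add: ky nat_pow_mult[symmetric] nat_pow_pow[symmetric])
  qed
  have powA: "a [^] m \<in> A" if "a \<in> A" for a and m :: nat
    using that by (induction m) auto
  have rootex: "\<exists>a\<in>A. a [^] n = b" if b: "b \<in> A" for b
    using root[OF b] powA[OF b, of k] b by (intro bexI[of _ "b [^] k"]) (simp_all add: nat_pow_pow mult.commute)
  have pow_triv: "a = \<one>" if "a \<in> A" "a [^] n = \<one>" for a
    using root[OF that(1)] that by (metis Ac nat_pow_one nat_pow_pow)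
  define T where "T = {x \<in> V. \<phi> r x = \<one>}"
  have one_T: "\<phi> r \<one> = \<one>" using \<phi>_on_A[of \<one>] by simp
  show thesis
  proof (rule that[of T])
    show "subgroup T G"
    proof
      show "T \<subseteq> carrier G" by (auto simp: T_def)
      show "\<one> \<in> T" using one_T by (simp add: T_def)
      fix x y assume "x \<in> T" "y \<in> T"
      then show "x \<otimes> y \<in> T" by (simp add: T_def cocycle[OF tr])
    next
      fix x assume "x \<in> T"
      then have x: "x \<in> V" "\<phi> r x = \<one>" by (auto simp: T_def)
      have "\<phi> r (inv x \<otimes> x) = \<phi> r (inv x)"
        using cocycle[OF tr, of "inv x" x] x \<phi>A[OF tr, of "inv x"] by simp
      then show "inv x \<in> T" using x one_T by (simp add: T_def)
    qed
    show "T \<subseteq> V" by (auto simp: T_def)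
    show "A \<inter> T = {\<one>}"
      using \<phi>_on_A pow_triv one_T by (auto simp: T_def)
    show "V \<subseteq> A <#> T"
    proof
      fix v assume v: "v \<in> V"
      have b: "\<phi> r v \<in> A" using \<phi>A[OF tr v] .
      \<comment> \<open>For this a the value at av is a \<phi>(v) a^-1 a^n = 1, because A is
        commutative.\<close>
      obtain a where a: "a \<in> A" "a [^] n = inv (\<phi> r v)" using rootex[of "inv (\<phi> r v)"] b by auto
      have "a \<otimes> \<phi> r v = \<phi> r v \<otimes> a" using a b by (intro comm) auto
      then have "a \<otimes> \<phi> r v \<otimes> inv a = \<phi> r v" using a b by (simp add: group_normalize)
      then have "\<phi> r (a \<otimes> v) = \<one>"
        using cocycle[OF tr, of a v] a v AV b \<phi>_on_A[of a] by auto
      then have "a \<otimes> v \<in> T" using a v AV by (auto simp: T_def)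
      moreover have "v = inv a \<otimes> (a \<otimes> v)" using a v by (simp add: group_normalize)
      ultimately show "v \<in> A <#> T" using a unfolding set_mult_def by blast
    qed
    fix g assume g: "g \<in> carrier G"
    \<comment> \<open>Conjugation by g carries the transversal \<open>r\<close> to another
      transversal \<open>s\<close>; \<open>\<kappa>\<close> is the permutation of cosets needed to
      index \<open>s\<close> by the coset in which its value lies.\<close>
    define \<kappa> where "\<kappa> c = K (inv g \<otimes> r c \<otimes> g)" for c
    have conjV': "inv g \<otimes> v \<otimes> g \<in> V" if "v \<in> V" for v
      using conjV[of "inv g" v] g that by simp
    have \<kappa>C: "\<kappa> c \<in> C" if "c \<in> C" for c
      using that r conjV' unfolding \<kappa>_def C_def by blast
    have \<kappa>_inj: "inj_on \<kappa> C"
    proof (rule inj_onI)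
      fix c d assume c: "c \<in> C" and d: "d \<in> C" and eq: "\<kappa> c = \<kappa> d"
      have "K (g \<otimes> (inv g \<otimes> r c \<otimes> g) \<otimes> inv g) = K (g \<otimes> (inv g \<otimes> r d \<otimes> g) \<otimes> inv g)"
        using g r(1)[OF c] r(1)[OF d]
        by (intro Kmultr[OF Kmult[OF eq[unfolded \<kappa>_def]]]) auto
      then have "K (r c) = K (r d)" using g r(1)[OF c] r(1)[OF d] by (simp add: group_normalize)
      then show "c = d" by (simp add: r(2) c d)
    qed
    have \<kappa>_img: "\<kappa> ` C = C" using \<kappa>C \<kappa>_inj finC by (intro endo_inj_surj) auto
    define s where "s c = g \<otimes> r (\<kappa> c) \<otimes> inv g" for c
    have ts: "trans s"
      unfolding trans_def
    proof (intro ballI conjI)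
      fix c assume c: "c \<in> C"
      show "s c \<in> V" unfolding s_def using c r \<kappa>C g conjV by auto
      have "K (s c) = K (g \<otimes> (inv g \<otimes> r c \<otimes> g) \<otimes> inv g)"
        unfolding s_def using r(1)[OF c] r[OF \<kappa>C[OF c]] g
        by (intro Kmultr Kmult) (auto simp: \<kappa>_def)
      then show "K (s c) = c" using r[OF c] g by (simp add: group_normalize)
    qed
    have conj_\<phi>: "\<phi> s (g \<otimes> x \<otimes> inv g) = g \<otimes> \<phi> r x \<otimes> inv g" if x: "x \<in> V" for x
    proof -
      let ?y = "g \<otimes> x \<otimes> inv g"
      have y: "?y \<in> V" using g x conjV by simp
      have "g \<otimes> \<phi> r x \<otimes> inv g = finprod AA (\<lambda>c. g \<otimes> f r x (\<kappa> c) \<otimes> inv g) C"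
        unfolding \<phi>_def using g x fA[OF tr]
        by (subst reindex[OF \<kappa>_inj \<kappa>_img], simp, subst conj_finprod, simp_all add: \<kappa>C)
      also have "\<dots> = \<phi> s ?y"
        unfolding \<phi>_def
      proof (rule cong)
        fix c assume c: "c \<in> C"
        have rc: "r c \<in> V" "r (\<kappa> c) \<in> V" "r (act ?y c) \<in> V" "r (act x (\<kappa> c)) \<in> V"
          using r c \<kappa>C actC x y by auto
        have "\<kappa> (act ?y c) = K (inv g \<otimes> (?y \<otimes> r c) \<otimes> g)"
          unfolding \<kappa>_def using rc c r(2)[OF actC[OF y c]] g x
          by (intro Kmultr Kmult) (auto simp: act_def)
        also have "\<dots> = K (x \<otimes> (inv g \<otimes> r c \<otimes> g))"
          using g x rc by (simp add: group_normalize)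
        also have "\<dots> = act x (\<kappa> c)"
          using act_K[of x "inv g \<otimes> r c \<otimes> g"] x conjV' rc by (simp add: \<kappa>_def)
        finally show "g \<otimes> f r x (\<kappa> c) \<otimes> inv g = f s ?y c"
          unfolding f_def s_def using g x rc by (simp add: group_normalize)
        show "f s ?y c \<in> A" by (rule fA[OF ts y c])
      qed
      finally show ?thesis by simp
    qed
    \<comment> \<open>The ratios of the two transversals, multiplied over all cosets: the two
      crossed homomorphisms differ by the coboundary of b. An n-th root a of b turns this into
      conjugation by a.\<close>
    define b where "b = finprod AA (\<lambda>c. s c \<otimes> inv (r c)) C"
    have dA: "s c \<otimes> inv (r c) \<in> A" if "c \<in> C" for c
      using that ts tr Keq[of "s c" "r c"] by (auto simp: trans_def)
    have bA: "b \<in> A"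
      unfolding b_def using AA.finprod_closed[of "\<lambda>c. s c \<otimes> inv (r c)" C] dA by auto
    have cob: "\<phi> s y \<otimes> b = (y \<otimes> b \<otimes> inv y) \<otimes> \<phi> r y" if y: "y \<in> V" for y
    proof -
      have c_in: "s c \<in> V" "r c \<in> V" "s (act y c) \<in> V" "r (act y c) \<in> V" if "c \<in> C" for c
        using that ts tr actC[OF y that] by (auto simp: trans_def)
      have "\<phi> s y \<otimes> b = \<phi> s y \<otimes> finprod AA (\<lambda>c. s (act y c) \<otimes> inv (r (act y c))) C"
        unfolding b_def using dA by (subst reindex[OF act_inj[OF y] act_img[OF y]]) auto
      also have "\<dots> = finprod AA (\<lambda>c. f s y c \<otimes> (s (act y c) \<otimes> inv (r (act y c)))) C"
        unfolding \<phi>_def using fA[OF ts y] dA actC[OF y] by (intro mult_finprod) auto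
      also have "\<dots> = finprod AA (\<lambda>c. (y \<otimes> (s c \<otimes> inv (r c)) \<otimes> inv y) \<otimes> f r y c) C"
      proof (rule cong)
        fix c assume c: "c \<in> C"
        show "f s y c \<otimes> (s (act y c) \<otimes> inv (r (act y c))) =
          (y \<otimes> (s c \<otimes> inv (r c)) \<otimes> inv y) \<otimes> f r y c"
          unfolding f_def using c_in[OF c] y by (simp add: group_normalize)
        show "(y \<otimes> (s c \<otimes> inv (r c)) \<otimes> inv y) \<otimes> f r y c \<in> A"
          using fA[OF tr y c] conjA dA c y by simp
      qed
      also have "\<dots> = (y \<otimes> b \<otimes> inv y) \<otimes> \<phi> r y"
        unfolding b_def \<phi>_def using fA[OF tr y] dA conjA y
        by (subst conj_finprod, simp_all, subst mult_finprod, simp_all)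
      finally show ?thesis .
    qed
    obtain a where a: "a \<in> A" "a [^] n = b" using rootex[OF bA] by blast
    have aV: "a \<in> V" using a AV by blast
    have \<phi>a': "\<phi> r (inv a) = inv b"
      using \<phi>_on_A[of "inv a"] a by (simp add: nat_pow_inv)
    have eq: "\<phi> r (inv a \<otimes> y \<otimes> a) = \<phi> s y" if y: "y \<in> V" for y
    proof -
      have yb: "\<phi> r (y \<otimes> a) = \<phi> s y \<otimes> b"
        using cocycle[OF tr y aV] \<phi>_on_A[OF a(1)] a(2) cob[OF y] by simp
      have sA: "\<phi> s y \<in> A" using \<phi>A[OF ts y] .
      have "\<phi> r (inv a \<otimes> (y \<otimes> a)) = (inv a \<otimes> (\<phi> s y \<otimes> b) \<otimes> a) \<otimes> inv b"
        using cocycle[OF tr, of "inv a" "y \<otimes> a"] aV y a \<phi>a' yb by simp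
      also have "inv a \<otimes> (\<phi> s y \<otimes> b) = (\<phi> s y \<otimes> b) \<otimes> inv a"
        using a sA bA by (intro comm) auto
      also have "(\<phi> s y \<otimes> b) \<otimes> inv a \<otimes> a \<otimes> inv b = \<phi> s y"
        using a sA bA by (simp add: group_normalize)
      finally show ?thesis using a y by (simp add: m_assoc)
    qed
    \<comment> \<open>The kernel of \<open>\<phi> s\<close> contains g T g^-1 by
      \<open>conj_\<phi>\<close> and equals a T a^-1 by \<open>eq\<close>; hence a^-1 g normalizes
      T.\<close>
    show "\<exists>a\<in>A. \<forall>t\<in>T. (a \<otimes> g) \<otimes> t \<otimes> inv (a \<otimes> g) \<in> T"
    proof (intro bexI[of _ "inv a"] ballI)
      fix t assume "t \<in> T"
      then have t: "t \<in> V" "\<phi> r t = \<one>" by (auto simp: T_def)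
      let ?y = "g \<otimes> t \<otimes> inv g"
      have y: "?y \<in> V" using conjV g t by simp
      have "\<phi> r (inv a \<otimes> ?y \<otimes> a) = \<one>"
        using eq[OF y] conj_\<phi>[OF t(1)] t g by simp
      moreover have "inv a \<otimes> ?y \<otimes> a \<in> V" using y aV by simp
      ultimately have "inv a \<otimes> ?y \<otimes> a \<in> T" by (simp add: T_def)
      then show "(inv a \<otimes> g) \<otimes> t \<otimes> inv (inv a \<otimes> g) \<in> T"
        using a g t by (simp add: group_normalize)
    qed (use a in simp)
  qed
qed


section \<open>Complements in sections, by passage to a quotient\<close>

lemma card_image_rcos:
  assumes "subgroup E G" "subgroup D G" "E \<subseteq> D" "finite (carrier G)"
  shows "card ((#>) E ` D) = card D div card E"
proof -
  have "(#>) E ` D = rcosets\<^bsub>G\<lparr>carrier := D\<rparr>\<^esub> E"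
    by (auto simp: RCOSETS_def r_coset_def)
  moreover have "card (rcosets\<^bsub>G\<lparr>carrier := D\<rparr>\<^esub> E) * card E = card D"
    using group.lagrange[OF subgroup_imp_group[OF assms(2)] subgroup_incl[OF assms(1-3)]]
    by (simp add: order_def)
  moreover have "card E \<noteq> 0"
    using assms subgroup.one_closed subgroup.subset by (metis card_eq_0_iff empty_iff finite_subset)
  ultimately show ?thesis by (metis nonzero_mult_div_cancel_right)
qed

text \<open>The abelian case is applied in G/E, and W is the full preimage of the complement found
  there. The last clause amounts to G = D N(W), a Frattini argument for complements; both normality
  proofs for such a W start from it.\<close>

theorem abelian_section_complement:
  assumes fin: "finite (carrier G)"
    and E: "E \<lhd> G" and D: "D \<lhd> G" and V: "V \<lhd> G" and ED: "E \<subseteq> D" and DV: "D \<subseteq> V"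
    and comm: "\<And>a b. a \<in> D \<Longrightarrow> b \<in> D \<Longrightarrow> a \<otimes> b \<otimes> inv a \<otimes> inv b \<in> E"
    and cop: "coprime (card D div card E) (card V div card D)"
  obtains W where "subgroup W G" "E \<subseteq> W" "W \<subseteq> V" "D \<inter> W = E" "V \<subseteq> D <#> W"
    "\<And>g. g \<in> carrier G \<Longrightarrow> \<exists>d\<in>D. \<forall>w\<in>W. (d \<otimes> g) \<otimes> w \<otimes> inv (d \<otimes> g) \<in> W"
proof -
  interpret E: normal E G by (rule E)
  interpret D: normal D G by (rule D)
  interpret V: normal V G by (rule V)
  interpret Q: group "G Mod E" by (rule E.factorgroup_is_group)
  define \<pi> where "\<pi> x = E #> x" for x
  interpret \<pi>: group_hom G "G Mod E" \<pi>
    unfolding \<pi>_def by unfold_locales (rule E.r_coset_hom_Mod)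
  have surj: "\<pi> ` carrier G = carrier (G Mod E)" by (simp add: carrier_FactGroup \<pi>_def image_def)
  have \<pi>_eq: "\<pi> x = \<pi> y \<longleftrightarrow> x \<otimes> inv y \<in> E" if "x \<in> carrier G" "y \<in> carrier G" for x y
    unfolding \<pi>_def using rcos_eq_iff[OF E.subgroup_axioms that] .
  have \<pi>_one: "\<pi> x = \<one>\<^bsub>G Mod E\<^esub> \<longleftrightarrow> x \<in> E" if "x \<in> carrier G" for x
    using \<pi>_eq[OF that one_closed] that \<pi>.hom_one by simp
  have EV: "E \<subseteq> V" using ED DV by blast
  have finQ: "finite (carrier (G Mod E))" using fin by (simp add: surj[symmetric])
  have cD: "card (\<pi> ` D) = card D div card E"
    unfolding \<pi>_def using card_image_rcos[OF E.subgroup_axioms D.subgroup_axioms ED fin] by simp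
  have cV: "card (\<pi> ` V) = card V div card E"
    unfolding \<pi>_def using card_image_rcos[OF E.subgroup_axioms V.subgroup_axioms EV fin] by simp
  have "card E dvd card D" "card E dvd card V"
    using card_subgroup_dvd E.subgroup_axioms D.subgroup_axioms V.subgroup_axioms ED EV by auto
  moreover have "card E \<noteq> 0"
    using fin E.subset E.one_closed by (metis card_eq_0_iff empty_iff finite_subset)
  ultimately have cVD: "card (\<pi> ` V) div card (\<pi> ` D) = card V div card D"
    unfolding cD cV by (auto elim!: dvdE)
  obtain T where T: "subgroup T (G Mod E)" "T \<subseteq> \<pi> ` V" "\<pi> ` D \<inter> T = {\<one>\<^bsub>G Mod E\<^esub>}"
      "\<pi> ` V \<subseteq> \<pi> ` D <#>\<^bsub>G Mod E\<^esub> T"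
      "\<And>g. g \<in> carrier (G Mod E) \<Longrightarrow> \<exists>a\<in>\<pi> ` D. \<forall>t\<in>T.
         (a \<otimes>\<^bsub>G Mod E\<^esub> g) \<otimes>\<^bsub>G Mod E\<^esub> t \<otimes>\<^bsub>G Mod E\<^esub> inv\<^bsub>G Mod E\<^esub> (a \<otimes>\<^bsub>G Mod E\<^esub> g) \<in> T"
  proof (rule Q.abelian_normal_complement[OF finQ, of "\<pi> ` D" "\<pi> ` V"])
    show "\<pi> ` D \<lhd> G Mod E" "\<pi> ` V \<lhd> G Mod E"
      using D.surj_hom_normal_subgroup[OF \<pi>.group_hom_axioms surj]
        V.surj_hom_normal_subgroup[OF \<pi>.group_hom_axioms surj] by auto
    show "\<pi> ` D \<subseteq> \<pi> ` V" using DV by blast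
    show "coprime (card (\<pi> ` D)) (card (\<pi> ` V) div card (\<pi> ` D))"
      unfolding cVD unfolding cD by (rule cop)
  next
    fix x y assume "x \<in> \<pi> ` D" "y \<in> \<pi> ` D"
    then obtain a b where ab: "a \<in> D" "b \<in> D" "x = \<pi> a" "y = \<pi> b" by blast
    have "(a \<otimes> b) \<otimes> inv (b \<otimes> a) \<in> E"
      using comm[OF ab(1,2)] ab by (simp add: group_normalize)
    then have "\<pi> (a \<otimes> b) = \<pi> (b \<otimes> a)" using ab by (subst \<pi>_eq) auto
    then show "x \<otimes>\<^bsub>G Mod E\<^esub> y = y \<otimes>\<^bsub>G Mod E\<^esub> x" 
      using ab by (metis \<pi>.hom_mult D.mem_carrier)
  qed blast
  define W where "W = {x \<in> carrier G. \<pi> x \<in> T}"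
  show thesis
  proof (rule that[of W])
    show "subgroup W G"
    proof
      show "W \<subseteq> carrier G" by (auto simp: W_def)
      show "\<one> \<in> W" using subgroup.one_closed[OF T(1)] \<pi>.hom_one by (simp add: W_def)
      fix x y assume "x \<in> W" "y \<in> W"
      then show "x \<otimes> y \<in> W"
        using subgroup.m_closed[OF T(1)] unfolding W_def by (simp only: mem_Collect_eq \<pi>.hom_mult m_closed)
    next
      fix x assume "x \<in> W"
      then show "inv x \<in> W"
        using subgroup.m_inv_closed[OF T(1)] unfolding W_def by (simp only: mem_Collect_eq \<pi>.hom_inv inv_closed)
    qed
    show EW: "E \<subseteq> W"
    proof
      fix x assume x: "x \<in> E"
      then have "\<pi> x = \<one>\<^bsub>G Mod E\<^esub>" using \<pi>_one[of x] by simp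
      then show "x \<in> W" using subgroup.one_closed[OF T(1)] x by (simp add: W_def)
    qed
    show "W \<subseteq> V"
    proof
      fix x assume "x \<in> W"
      then have x: "x \<in> carrier G" "\<pi> x \<in> T" by (auto simp: W_def)
      then obtain v where v: "v \<in> V" "\<pi> x = \<pi> v" using T(2) by blast
      then have "x \<otimes> inv v \<in> V" using x(1) \<pi>_eq[OF x(1) V.mem_carrier[OF v(1)]] EV by blast
      then have "x \<otimes> inv v \<otimes> v \<in> V" using v(1) by (rule V.m_closed)
      then show "x \<in> V" using x v by (simp add: group_normalize)
    qed
    show "D \<inter> W = E"
    proof
      show "E \<subseteq> D \<inter> W" using ED EW by blast
      show "D \<inter> W \<subseteq> E"
      proof
        fix x assume "x \<in> D \<inter> W"
        then have x: "x \<in> carrier G" "\<pi> x \<in> \<pi> ` D \<inter> T" by (auto simp: W_def)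
        then have "\<pi> x = \<one>\<^bsub>G Mod E\<^esub>" unfolding T(3) by simp
        then show "x \<in> E" using \<pi>_one[OF x(1)] by simp
      qed
    qed
    show "V \<subseteq> D <#> W"
    proof
      fix v assume v: "v \<in> V"
      then obtain d t where dt: "d \<in> D" "t \<in> T" "\<pi> v = \<pi> d \<otimes>\<^bsub>G Mod E\<^esub> t"
        using T(4) unfolding set_mult_def by blast
      have tc: "t \<in> carrier (G Mod E)" using dt subgroup.mem_carrier[OF T(1)] by blast
      have "\<pi> (inv d \<otimes> v) = inv\<^bsub>G Mod E\<^esub> (\<pi> d) \<otimes>\<^bsub>G Mod E\<^esub> (\<pi> d \<otimes>\<^bsub>G Mod E\<^esub> t)"
        using dt v by (simp only: \<pi>.hom_mult \<pi>.hom_inv inv_closed D.mem_carrier V.mem_carrier)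
      also have "\<dots> = t"
        using tc dt by (intro Q.inv_mult_cancel_left) auto
      finally have "inv d \<otimes> v \<in> W" using dt v by (simp add: W_def)
      moreover have "v = d \<otimes> (inv d \<otimes> v)" using dt v by (simp add: group_normalize)
      ultimately show "v \<in> D <#> W" using dt unfolding set_mult_def by blast
    qed
    fix g assume g: "g \<in> carrier G"
    then obtain d where d: "d \<in> D" and dT: "\<And>t. t \<in> T \<Longrightarrow>
        (\<pi> d \<otimes>\<^bsub>G Mod E\<^esub> \<pi> g) \<otimes>\<^bsub>G Mod E\<^esub> t \<otimes>\<^bsub>G Mod E\<^esub> inv\<^bsub>G Mod E\<^esub> (\<pi> d \<otimes>\<^bsub>G Mod E\<^esub> \<pi> g) \<in> T"
      using T(5)[OF \<pi>.hom_closed[OF g]] by blast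
    show "\<exists>d\<in>D. \<forall>w\<in>W. (d \<otimes> g) \<otimes> w \<otimes> inv (d \<otimes> g) \<in> W"
    proof (intro bexI[of _ d] ballI d)
      fix w assume "w \<in> W"
      then have w: "w \<in> carrier G" "\<pi> w \<in> T" by (auto simp: W_def)
      have "\<pi> ((d \<otimes> g) \<otimes> w \<otimes> inv (d \<otimes> g)) \<in> T"
        using dT[OF w(2)] w d g
        by (simp only: \<pi>.hom_mult \<pi>.hom_inv inv_closed m_closed D.mem_carrier)
      then show "(d \<otimes> g) \<otimes> w \<otimes> inv (d \<otimes> g) \<in> W" using w d g by (simp add: W_def)
    qed
  qed
qed

section \<open>Normalizers, centralizers modulo a normal subgroup, and derived subgroups of
  p-groups\<close>

lemma normalizer_iff:
  assumes M: "M \<subseteq> carrier G" and fin: "finite (carrier G)"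
  shows "g \<in> normalizer G M \<longleftrightarrow> g \<in> carrier G \<and> (\<forall>x\<in>M. g \<otimes> x \<otimes> inv g \<in> M)"
proof -
  have eq: "g <# M #> inv g = (\<lambda>x. g \<otimes> x \<otimes> inv g) ` M"
    by (auto simp: l_coset_def r_coset_def)
  \<comment> \<open>On a finite M the injection x \<mapsto> g x g^-1 of M into itself is onto, so
    one inclusion suffices.\<close>
  have "(\<lambda>x. g \<otimes> x \<otimes> inv g) ` M = M" if g: "g \<in> carrier G" and "\<forall>x\<in>M. g \<otimes> x \<otimes> inv g \<in> M"
  proof (rule endo_inj_surj)
    show "finite M" using M fin finite_subset by blast
    show "(\<lambda>x. g \<otimes> x \<otimes> inv g) ` M \<subseteq> M" using that by blast
    show "inj_on (\<lambda>x. g \<otimes> x \<otimes> inv g) M"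
      using M g by (intro inj_onI) (metis inv_closed m_closed r_cancel l_cancel subsetD)
  qed
  then show ?thesis
    unfolding normalizer_def stabilizer_def using M eq by auto
qed

text \<open>This is the preimage of the centralizer in G/K of the image of S. Closure rests on
  [gh,s] = g [h,s] g^-1 [g,s] and [g^-1,s] = g^-1 [g,s]^-1 g. Allowing any subset S covers single
  elements as well as N.\<close>

lemma centralizer_mod_subgroup:
  assumes K: "K \<lhd> G" and S: "S \<subseteq> carrier G"
  shows "subgroup {g \<in> carrier G. \<forall>s\<in>S. g \<otimes> s \<otimes> inv g \<otimes> inv s \<in> K} G"
proof -
  interpret K: normal K G by (rule K)
  have Sc: "s \<in> carrier G" if "s \<in> S" for s using that S by blast
  show ?thesis
  proof
    show "\<one> \<in> {g \<in> carrier G. \<forall>s\<in>S. g \<otimes> s \<otimes> inv g \<otimes> inv s \<in> K}"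
      using Sc by simp
  next
    fix g h
    assume "g \<in> {g \<in> carrier G. \<forall>s\<in>S. g \<otimes> s \<otimes> inv g \<otimes> inv s \<in> K}"
      "h \<in> {g \<in> carrier G. \<forall>s\<in>S. g \<otimes> s \<otimes> inv g \<otimes> inv s \<in> K}"
    then have g: "g \<in> carrier G" "\<And>s. s \<in> S \<Longrightarrow> g \<otimes> s \<otimes> inv g \<otimes> inv s \<in> K"
      and h: "h \<in> carrier G" "\<And>s. s \<in> S \<Longrightarrow> h \<otimes> s \<otimes> inv h \<otimes> inv s \<in> K" by auto
    have "g \<otimes> h \<otimes> s \<otimes> inv (g \<otimes> h) \<otimes> inv s \<in> K" if s: "s \<in> S" for s
    proof -
      have "g \<otimes> (h \<otimes> s \<otimes> inv h \<otimes> inv s) \<otimes> inv g \<otimes> (g \<otimes> s \<otimes> inv g \<otimes> inv s) \<in> K"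
        by (intro K.m_closed K.inv_op_closed2 g h s)
      then show ?thesis using g(1) h(1) Sc[OF s] by (simp add: group_normalize)
    qed
    then show "g \<otimes> h \<in> {g \<in> carrier G. \<forall>s\<in>S. g \<otimes> s \<otimes> inv g \<otimes> inv s \<in> K}"
      using g h by simp
  next
    fix g
    assume "g \<in> {g \<in> carrier G. \<forall>s\<in>S. g \<otimes> s \<otimes> inv g \<otimes> inv s \<in> K}"
    then have g: "g \<in> carrier G" "\<And>s. s \<in> S \<Longrightarrow> g \<otimes> s \<otimes> inv g \<otimes> inv s \<in> K" by auto
    have "inv g \<otimes> s \<otimes> inv (inv g) \<otimes> inv s \<in> K" if s: "s \<in> S" for s
    proof -
      have "inv g \<otimes> inv (g \<otimes> s \<otimes> inv g \<otimes> inv s) \<otimes> g \<in> K"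
        by (intro K.inv_op_closed1 K.m_inv_closed g s)
      then show ?thesis using g(1) Sc[OF s] by (simp add: group_normalize)
    qed
    then show "inv g \<in> {g \<in> carrier G. \<forall>s\<in>S. g \<otimes> s \<otimes> inv g \<otimes> inv s \<in> K}"
      using g by simp
  qed auto
qed

lemma centralizer_mod_normal:
  assumes K: "K \<lhd> G" and S: "S \<lhd> G"
  shows "{g \<in> carrier G. \<forall>s\<in>S. g \<otimes> s \<otimes> inv g \<otimes> inv s \<in> K} \<lhd> G" (is "?C \<lhd> G")
  unfolding normal_inv_iff
proof (intro conjI ballI)
  interpret K: normal K G by (rule K)
  interpret S: normal S G by (rule S)
  show "subgroup ?C G" by (rule centralizer_mod_subgroup[OF K S.subset])
  fix x g assume x: "x \<in> carrier G" and "g \<in> ?C"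
  then have g: "g \<in> carrier G" "\<And>s. s \<in> S \<Longrightarrow> g \<otimes> s \<otimes> inv g \<otimes> inv s \<in> K" by auto
  have "x \<otimes> g \<otimes> inv x \<otimes> s \<otimes> inv (x \<otimes> g \<otimes> inv x) \<otimes> inv s \<in> K" if s: "s \<in> S" for s
  proof -
    \<comment> \<open>[x g x^-1, s] is the conjugate by x of [g, x^-1 s x], and x^-1 s x is again in
      S.\<close>
    let ?s = "inv x \<otimes> s \<otimes> x"
    have "x \<otimes> (g \<otimes> ?s \<otimes> inv g \<otimes> inv ?s) \<otimes> inv x \<in> K"
      by (intro K.inv_op_closed2 S.inv_op_closed1 g s x)
    then show ?thesis using g(1) x s by (simp add: group_normalize)
  qed
  then show "x \<otimes> g \<otimes> inv x \<in> ?C" using g x by simp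
qed

text \<open>A maximal proper subgroup M is normal, because normalizers grow. For x outside M the
  centralizer of x modulo M contains M and x, hence is the whole group; so G/M is abelian and M
  contains the derived subgroup.\<close>

lemma p_group_derived_proper:
  assumes fin: "finite (carrier G)" and p: "Factorial_Ring.prime p"
    and ord: "order G = p ^ n" and triv: "carrier G \<noteq> {\<one>}"
  shows "derived G (carrier G) \<noteq> carrier G"
proof -
  let ?S = "{M. subgroup M G \<and> M \<noteq> carrier G}"
  have "finite ?S" using fin subgroup.subset by (intro finite_subset[of ?S "Pow (carrier G)"]) auto
  moreover have "{\<one>} \<in> ?S" using triv triv_subgroup by auto
  ultimately obtain M where M: "subgroup M G" "M \<noteq> carrier G"
    and maxM: "\<And>U. subgroup U G \<Longrightarrow> M \<subseteq> U \<Longrightarrow> U \<noteq> M \<Longrightarrow> U = carrier G"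
    using finite_has_maximal2[of ?S "{\<one>}"] by auto
  obtain g where g: "g \<in> carrier G" "g \<notin> M" "\<And>x. x \<in> M \<Longrightarrow> g \<otimes> x \<otimes> inv g \<in> M"
    using p_group_normalizer_grows[OF fin p ord M] by blast
  note Mc = subgroup.subset[OF M(1)]
  have "normalizer G M = carrier G"
  proof (rule maxM)
    show "subgroup (normalizer G M) G" by (rule normalizer_imp_subgroup[OF Mc])
    show "M \<subseteq> normalizer G M"
      using Mc subgroup.m_closed[OF M(1)] subgroup.m_inv_closed[OF M(1)]
      by (auto simp: normalizer_iff[OF Mc fin])
    show "normalizer G M \<noteq> M" using g by (auto simp: normalizer_iff[OF Mc fin])
  qed
  then have nM: "M \<lhd> G"
    using M(1) normalizer_iff[OF Mc fin] by (auto simp: normal_inv_iff)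
  interpret M: normal M G by (rule nM)
  let ?Z = "\<lambda>x. {y \<in> carrier G. \<forall>s\<in>{x}. y \<otimes> s \<otimes> inv y \<otimes> inv s \<in> M}"
  have "y \<in> ?Z x" if x: "x \<in> carrier G" "x \<notin> M" and y: "y \<in> carrier G" for x y
  proof -
    have "?Z x = carrier G"
    proof (rule maxM)
      show "subgroup (?Z x) G" using x by (intro centralizer_mod_subgroup[OF nM]) auto
      show "M \<subseteq> ?Z x"
      proof
        fix m assume m: "m \<in> M"
        have "m \<otimes> (x \<otimes> inv m \<otimes> inv x) \<in> M"
          using m x by (intro M.m_closed M.inv_op_closed2) auto
        then show "m \<in> ?Z x" using m x by (simp add: group_normalize)
      qed
      have "x \<in> ?Z x" using x by (simp add: group_normalize)
      then show "?Z x \<noteq> M" using x by blast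
    qed
    then show ?thesis using y by blast
  qed
  then have comm: "y \<otimes> x \<otimes> inv y \<otimes> inv x \<in> M" if "x \<in> carrier G" "x \<notin> M" "y \<in> carrier G" for x y
    using that by blast
  have comm: "y \<otimes> x \<otimes> inv y \<otimes> inv x \<in> M" if x: "x \<in> carrier G" and y: "y \<in> carrier G" for x y
  proof (cases "x \<in> M")
    case True
    then show ?thesis using y by (intro M.m_closed M.inv_op_closed2) auto
  qed (use comm x y in blast)
  have "derived G (carrier G) \<subseteq> M"
    unfolding derived_def by (rule generate_subgroup_incl[OF _ M(1)]) (use comm in auto)
  then show ?thesis using M(2) Mc by blast
qed

lemma p_subgroup_derived_proper:
  assumes fin: "finite (carrier G)" and p: "Factorial_Ring.prime p"
    and D: "subgroup D G" "card D = p ^ n" "D \<noteq> {\<one>}"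
  shows "derived G D \<noteq> D"
proof -
  have "derived (G\<lparr>carrier := D\<rparr>) D \<noteq> D"
    using group.p_group_derived_proper[OF subgroup_imp_group[OF D(1)] _ p, of n] D fin
      finite_subset[OF subgroup.subset[OF D(1)]] by (simp add: order_def)
  then show ?thesis using derived_consistent[OF _ D(1), of D] by simp
qed

end

subsection \<open>Sylow subgroups and semipermutability\<close>

context group
begin

section \<open>Products of subgroups, and orders of intersections with Sylow subgroups\<close>

lemma subgroup_set_mult_commute:
  assumes A: "subgroup A G" and B: "subgroup B G" and AB: "A <#> B = B <#> A"
  shows "subgroup (A <#> B) G"
proof
  note Ac = subgroup.subset[OF A] and Bc = subgroup.subset[OF B]
  show "A <#> B \<subseteq> carrier G" using Ac Bc by (rule setmult_subset_G)
  show "\<one> \<in> A <#> B"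
    using subgroup.one_closed[OF A] subgroup.one_closed[OF B] unfolding set_mult_def by force
  have "(A <#> B) <#> (A <#> B) = A <#> (B <#> A) <#> B"
    using Ac Bc by (simp add: set_mult_assoc setmult_subset_G)
  also have "\<dots> = (A <#> A) <#> (B <#> B)"
    unfolding AB[symmetric] using Ac Bc by (simp add: set_mult_assoc setmult_subset_G)
  also have "\<dots> = A <#> B" by (simp add: subgroup_mult_id A B)
  finally have eq: "(A <#> B) <#> (A <#> B) = A <#> B" .
  show "x \<otimes> y \<in> A <#> B" if "x \<in> A <#> B" "y \<in> A <#> B" for x y
  proof -
    have "x \<otimes> y \<in> (A <#> B) <#> (A <#> B)" using that unfolding set_mult_def[of G "A <#> B"] by blast
    then show ?thesis unfolding eq .
  qed
  show "inv x \<in> A <#> B" if x: "x \<in> A <#> B" for x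
  proof -
    obtain a b where ab: "a \<in> A" "b \<in> B" "x = a \<otimes> b" using x unfolding set_mult_def by blast
    then have "a \<in> carrier G" "b \<in> carrier G" using Ac Bc by blast+
    then have "inv x = inv b \<otimes> inv a" using ab by (simp add: inv_mult_group)
    moreover have "inv a \<in> A" "inv b \<in> B"
      using ab subgroup.m_inv_closed[OF A] subgroup.m_inv_closed[OF B] by auto
    ultimately have "inv x \<in> B <#> A" unfolding set_mult_def by blast
    then show ?thesis unfolding AB .
  qed
qed

lemma subset_set_mult:
  assumes "subgroup A G" "subgroup B G"
  shows "A \<subseteq> A <#> B" "B \<subseteq> A <#> B"
proof -
  show "A \<subseteq> A <#> B"
  proof
    fix a assume "a \<in> A"
    then have "a \<otimes> \<one> \<in> A <#> B" using subgroup.one_closed[OF assms(2)] unfolding set_mult_def by blast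
    then show "a \<in> A <#> B" using \<open>a \<in> A\<close> subgroup.mem_carrier[OF assms(1)] by simp
  qed
  show "B \<subseteq> A <#> B"
  proof
    fix b assume "b \<in> B"
    then have "\<one> \<otimes> b \<in> A <#> B" using subgroup.one_closed[OF assms(1)] unfolding set_mult_def by blast
    then show "b \<in> A <#> B" using \<open>b \<in> B\<close> subgroup.mem_carrier[OF assms(2)] by simp
  qed
qed

lemma set_mult_subset:
  assumes "subgroup S G" "A \<subseteq> S" "B \<subseteq> S"
  shows "A <#> B \<subseteq> S"
  using assms subgroup.m_closed[OF assms(1)] unfolding set_mult_def by blast

lemma card_subgroup_pos:
  assumes "subgroup A G" "finite (carrier G)"
  shows "card A > 0"
  using assms subgroup.one_closed[OF assms(1)] finite_subset[OF subgroup.subset[OF assms(1)]]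
  by (auto simp: card_gt_0_iff)

lemma card_Int_set_mult_trivial:
  assumes A: "subgroup A G" and B: "subgroup B G" and AB: "A \<inter> B = {\<one>}"
  shows "card (A <#> B) = card A * card B"
  using card_set_mult[OF A B] AB by simp

lemma coprime_Int_trivial:
  assumes "subgroup A G" "subgroup B G" "coprime (card A) (card B)" "finite (carrier G)"
  shows "A \<inter> B = {\<one>}"
proof -
  have s: "subgroup (A \<inter> B) G" using assms subgroups_Inter_pair by blast
  then have "card (A \<inter> B) dvd card A" "card (A \<inter> B) dvd card B"
    using assms card_subgroup_dvd by auto
  then have "card (A \<inter> B) = 1" using assms(3) by (metis coprime_common_divisor_nat)
  then obtain x where "A \<inter> B = {x}" by (rule card_1_singletonE)
  then show ?thesis using subgroup.one_closed[OF s] by auto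
qed

lemma sylow_subgroup_exists:
  assumes "finite (carrier G)" "Factorial_Ring.prime q"
  obtains Q where "sylow_subgroup G q Q"
proof -
  have "order G = q ^ multiplicity q (order G) * (order G div q ^ multiplicity q (order G))"
    by (simp add: multiplicity_dvd)
  from Sylow.sylow_thm[OF assms(2) is_group this assms(1)] show thesis
    using that unfolding sylow_subgroup_def by blast
qed

text \<open>Every full prime power of |G| divides |S|. The intended S is a normalizer: normality can
  then be tested with one Sylow subgroup per prime.\<close>

lemma eq_carrier_if_contains_sylows:
  assumes fin: "finite (carrier G)" and S: "subgroup S G"
    and syl: "\<And>q. Factorial_Ring.prime q \<Longrightarrow> \<exists>Q. sylow_subgroup G q Q \<and> Q \<subseteq> S"
  shows "S = carrier G"
proof -
  have "card S \<noteq> 0" using card_subgroup_pos[OF S fin] by simp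
  have "order G dvd card S"
  proof (rule multiplicity_le_imp_dvd)
    show "order G \<noteq> 0" using fin order_gt_0_iff_finite by simp
    fix q :: nat assume q: "Factorial_Ring.prime q"
    then obtain Q where Q: "sylow_subgroup G q Q" "Q \<subseteq> S" using syl by blast
    then have "q ^ multiplicity q (order G) dvd card S"
      using card_subgroup_dvd[OF _ S] unfolding sylow_subgroup_def by metis
    then show "multiplicity q (order G) \<le> multiplicity q (card S)"
      using \<open>card S \<noteq> 0\<close> q by (intro multiplicity_geI) auto
  qed
  then have "card (carrier G) \<le> card S" using \<open>card S \<noteq> 0\<close> by (simp add: order_def dvd_imp_le)
  then show ?thesis using fin subgroup.subset[OF S] by (metis card_seteq)
qed

text \<open>In |DP| |P \<inter> D| = |D| |P| the p-part of |DP| is at most |P|, so the p-part of |D|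
  is at most |P \<inter> D|.\<close>

lemma card_Int_sylow_normal:
  assumes fin: "finite (carrier G)" and p: "Factorial_Ring.prime p"
    and P: "sylow_subgroup G p P" and D: "D \<lhd> G"
  shows "card (P \<inter> D) = p ^ multiplicity p (card D)"
proof -
  have sP: "subgroup P G" and cP: "card P = p ^ multiplicity p (order G)"
    using P by (auto simp: sylow_subgroup_def)
  have sD: "subgroup D G" by (rule normal_imp_subgroup[OF D])
  have sI: "subgroup (P \<inter> D) G" using sP sD subgroups_Inter_pair by blast
  have sDP: "subgroup (D <#> P) G" using mult_norm_subgroup[OF D sP] .
  have eq: "card (D <#> P) * card (P \<inter> D) = card D * card P"
    using card_set_mult[OF sD sP] by (simp add: Int_commute)
  have nz: "card (D <#> P) \<noteq> 0" "card (P \<inter> D) \<noteq> 0" "card D \<noteq> 0" "card P \<noteq> 0"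
    using card_subgroup_pos fin sDP sI sD sP by fastforce+
  have "card (P \<inter> D) dvd p ^ multiplicity p (order G)"
    using card_subgroup_dvd[OF sI sP] cP by simp
  then obtain k where k: "card (P \<inter> D) = p ^ k" using p divides_primepow_nat by blast
  have "k \<le> multiplicity p (card D)"
    using card_subgroup_dvd[OF sI sD] k nz p by (intro multiplicity_geI) auto
  moreover have "multiplicity p (card D) \<le> k"
  proof -
    have "card (D <#> P) dvd order G"
      using card_subgroup_dvd[OF sDP subgroup_self] subgroup.subset[OF sDP] by (simp add: order_def)
    then have "multiplicity p (card (D <#> P)) \<le> multiplicity p (order G)"
      using fin order_gt_0_iff_finite by (intro dvd_imp_multiplicity_le) auto
    moreover have "multiplicity p (card (D <#> P)) + multiplicity p (card (P \<inter> D)) =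
        multiplicity p (card D) + multiplicity p (card P)"
      using arg_cong[OF eq, of "multiplicity p"] nz p
      by (simp add: prime_elem_multiplicity_mult_distrib)
    moreover have "multiplicity p (card (P \<inter> D)) = k" "multiplicity p (card P) = multiplicity p (order G)"
      unfolding k cP using p by (auto simp: multiplicity_prime_power)
    ultimately show ?thesis by simp
  qed
  ultimately show ?thesis using k by simp
qed

text \<open>P \<inter> D has the order of the p-group D/M and meets M trivially. Thus a section
  above M can be studied through a subgroup of P.\<close>

lemma eq_set_mult_Int_sylow:
  assumes fin: "finite (carrier G)" and p: "Factorial_Ring.prime p"
    and P: "sylow_subgroup G p P" and M: "M \<lhd> G" and pM: "\<not> p dvd card M"
    and D: "D \<lhd> G" and MD: "M \<subseteq> D" and cD: "card D = p ^ k * card M"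
  shows "D = M <#> (P \<inter> D)"
proof -
  have sM: "subgroup M G" and sD: "subgroup D G" and sI: "subgroup (P \<inter> D) G"
    using M D P normal_imp_subgroup subgroups_Inter_pair unfolding sylow_subgroup_def by blast+
  have cI: "card (P \<inter> D) = p ^ k"
  proof -
    have "card M \<noteq> 0" using card_subgroup_pos[OF sM fin] by simp
    then have "multiplicity p (card D) = k"
      unfolding cD using p pM by (simp add: prime_elem_multiplicity_mult_distrib
        multiplicity_prime_power not_dvd_imp_multiplicity_0)
    then show ?thesis using card_Int_sylow_normal[OF fin p P D] by simp
  qed
  have "coprime (card M) (card (P \<inter> D))"
    unfolding cI using p pM by (simp add: coprime_commute prime_imp_coprime)
  then have "card (M <#> (P \<inter> D)) = card D"
    using card_Int_set_mult_trivial[OF sM sI] coprime_Int_trivial[OF sM sI _ fin] cI cD by simp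
  moreover have "M <#> (P \<inter> D) \<subseteq> D" using set_mult_subset[OF sD] MD by blast
  moreover have "finite D" using fin subgroup.subset[OF sD] finite_subset by blast
  ultimately show ?thesis using card_subset_eq by metis
qed

lemma frattini_nongenerator:
  assumes fin: "finite (carrier G)" and P: "subgroup P G" and U: "subgroup U G" and UP: "U \<subseteq> P"
    and D: "D \<subseteq> frattini (G\<lparr>carrier := P\<rparr>)" and PDU: "P \<subseteq> D <#> U"
  shows "U = P"
proof (rule ccontr)
  assume "U \<noteq> P"
  let ?S = "{Y. subgroup Y G \<and> U \<subseteq> Y \<and> Y \<subset> P}"
  have "finite ?S" using fin subgroup.subset by (intro finite_subset[of ?S "Pow (carrier G)"]) auto
  moreover have "U \<in> ?S" using U UP \<open>U \<noteq> P\<close> by auto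
  ultimately obtain Y where Y: "subgroup Y G" "U \<subseteq> Y" "Y \<subset> P"
    and maxY: "\<And>Z. subgroup Z G \<Longrightarrow> Y \<subseteq> Z \<Longrightarrow> Z \<subset> P \<Longrightarrow> Z = Y"
    using finite_has_maximal2[of ?S U] by (smt (verit) mem_Collect_eq order_trans)
  have "maximal_subgroup Y (G\<lparr>carrier := P\<rparr>)"
    unfolding maximal_subgroup_def
  proof (intro conjI allI impI)
    show "subgroup Y (G\<lparr>carrier := P\<rparr>)" using subgroup_incl[OF Y(1) P] Y by blast
    show "Y \<noteq> carrier (G\<lparr>carrier := P\<rparr>)" using Y by auto
    fix K assume K: "subgroup K (G\<lparr>carrier := P\<rparr>) \<and> Y \<subseteq> K"
    then have "subgroup K G" "K \<subseteq> P"
      using incl_subgroup[OF P] subgroup.subset[of K "G\<lparr>carrier := P\<rparr>"] by auto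
    then show "K = Y \<or> K = carrier (G\<lparr>carrier := P\<rparr>)" using K maxY by auto
  qed
  \<comment> \<open>A proper U lies in a maximal subgroup Y of P; Y contains the Frattini subgroup,
    so D U cannot reach P.\<close>
  then have "D \<subseteq> Y" using D unfolding frattini_def by blast
  then have "D <#> U \<subseteq> Y" using set_mult_subset[OF Y(1)] Y by blast
  then show False using PDU Y by blast
qed

text \<open>The normalizer is tested prime by prime. P normalizes M H because g h g^-1 = [g,h] h
  with [g,h] in P' \<le> H. For q \<noteq> p the point is to rewrite the intersection as X \<inter>
  N with X = M H Q: this is normalized by Q, since Q lies in X and N is normal.\<close>

lemma s_semipermutable_core_normal:
  assumes fin: "finite (carrier G)" and p: "Factorial_Ring.prime p"
    and P: "sylow_subgroup G p P"
    and H: "s_semipermutable H G" and HP: "H \<subseteq> P" and PH: "derived G P \<subseteq> H"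
    and M: "M \<lhd> G" and pM: "\<not> p dvd card M"
    and N: "N \<lhd> G" and MN: "M \<subseteq> N" and cN: "card N = p ^ k * card M"
  shows "(M <#> H) \<inter> N \<lhd> G"
proof -
  interpret M: normal M G by (rule M)
  interpret N: normal N G by (rule N)
  have sP: "subgroup P G" and sH: "subgroup H G"
    using P H by (auto simp: sylow_subgroup_def s_semipermutable_def)
  have "card H dvd p ^ multiplicity p (order G)"
    using card_subgroup_dvd[OF sH sP HP] P by (simp add: sylow_subgroup_def)
  then obtain j where j: "card H = p ^ j" using p divides_primepow_nat by blast
  have sMH: "subgroup (M <#> H) G" by (rule mult_norm_subgroup[OF M sH])
  let ?K = "(M <#> H) \<inter> N"
  have sK: "subgroup ?K G" using sMH N.subgroup_axioms subgroups_Inter_pair by blast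
  note Kc = subgroup.subset[OF sK]
  have cMH: "card (M <#> H) = card M * card H"
    using card_Int_set_mult_trivial[OF M.subgroup_axioms sH] p pM j
      coprime_Int_trivial[OF M.subgroup_axioms sH _ fin] by (simp add: coprime_commute prime_imp_coprime)
  have "normalizer G ?K = carrier G"
  proof (rule eq_carrier_if_contains_sylows[OF fin normalizer_imp_subgroup[OF Kc]])
    fix q :: nat assume q: "Factorial_Ring.prime q"
    show "\<exists>Q. sylow_subgroup G q Q \<and> Q \<subseteq> normalizer G ?K"
    proof (cases "q = p")
      case True
      have "P \<subseteq> normalizer G ?K"
      proof
        fix g assume g: "g \<in> P"
        have gc: "g \<in> carrier G" using g subgroup.mem_carrier[OF sP] by blast
        have "g \<otimes> x \<otimes> inv g \<in> ?K" if x: "x \<in> ?K" for x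
        proof
          obtain m h where mh: "m \<in> M" "h \<in> H" "x = m \<otimes> h" using x unfolding set_mult_def by blast
          have hc: "h \<in> carrier G" using mh subgroup.mem_carrier[OF sH] by blast
          have "g \<otimes> h \<otimes> inv g \<otimes> inv h \<in> derived G P"
            unfolding derived_def using g mh HP by (intro generate.incl) blast
          then have "(g \<otimes> h \<otimes> inv g \<otimes> inv h) \<otimes> h \<in> H"
            using PH mh subgroup.m_closed[OF sH] by blast
          then have "g \<otimes> h \<otimes> inv g \<in> H" using gc hc by (simp add: group_normalize)
          moreover have "g \<otimes> m \<otimes> inv g \<in> M" using gc mh M.inv_op_closed2 by simp
          moreover have "g \<otimes> x \<otimes> inv g = (g \<otimes> m \<otimes> inv g) \<otimes> (g \<otimes> h \<otimes> inv g)"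
            using gc hc mh by (simp add: group_normalize)
          ultimately show "g \<otimes> x \<otimes> inv g \<in> M <#> H" unfolding set_mult_def by blast
          show "g \<otimes> x \<otimes> inv g \<in> N" using x gc by (intro N.inv_op_closed2) auto
        qed
        then show "g \<in> normalizer G ?K" using gc by (simp add: normalizer_iff[OF Kc fin])
      qed
      then show ?thesis using True P by blast
    next
      case False
      obtain Q where Q: "sylow_subgroup G q Q" using sylow_subgroup_exists[OF fin q] .
      then have sQ: "subgroup Q G" and cQ: "card Q = q ^ multiplicity q (order G)"
        by (auto simp: sylow_subgroup_def)
      have "\<not> q dvd card H" using False p q j by (metis prime_dvd_power primes_dvd_imp_eq)
      then have "H <#> Q = Q <#> H" using H q Q unfolding s_semipermutable_def by blast
      then have sB: "subgroup (H <#> Q) G" by (rule subgroup_set_mult_commute[OF sH sQ])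
      let ?X = "M <#> (H <#> Q)"
      have sX: "subgroup ?X G" by (rule mult_norm_subgroup[OF M sB])
      have sNH: "subgroup (N <#> H) G" by (rule mult_norm_subgroup[OF N sH])
      \<comment> \<open>The order of this intersection divides both p^k |MH| and a power of q times
        |MH|, hence |MH|. So it equals MH, and X \<inter> N is contained in MH.\<close>
      let ?U = "?X \<inter> (N <#> H)"
      have sU: "subgroup ?U G" using sX sNH subgroups_Inter_pair by blast
      have HX: "H \<subseteq> ?X" "Q \<subseteq> ?X" "M \<subseteq> ?X"
        using subset_set_mult[OF sH sQ] subset_set_mult[OF M.subgroup_axioms sB] by auto
      have MHU: "M <#> H \<subseteq> ?U"
      proof (rule set_mult_subset[OF sU])
        show "M \<subseteq> ?U" "H \<subseteq> ?U"
          using HX MN subset_set_mult[OF N.subgroup_axioms sH] by auto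
      qed
      have "card (N <#> H) dvd p ^ k * card (M <#> H)"
        using card_set_mult[OF N.subgroup_axioms sH] cN cMH by (metis dvd_triv_left mult.assoc)
      moreover have "card ?U dvd card (N <#> H)" by (rule card_subgroup_dvd[OF sU sNH]) blast
      ultimately have "card ?U dvd p ^ k * card (M <#> H)" by (rule dvd_trans[rotated])
      moreover have "card ?U dvd q ^ multiplicity q (order G) * card (M <#> H)"
      proof -
        have "card ?U dvd card ?X" by (rule card_subgroup_dvd[OF sU sX]) blast
        also have "card ?X dvd card M * card (H <#> Q)"
          using card_set_mult[OF M.subgroup_axioms sB] by (metis dvd_triv_left)
        also have "card M * card (H <#> Q) dvd card M * (card H * card Q)"
          using card_set_mult[OF sH sQ] by (metis dvd_triv_left mult_dvd_mono dvd_refl)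
        finally show ?thesis unfolding cMH cQ by (simp add: ac_simps)
      qed
      ultimately have "card ?U dvd gcd (p ^ k * card (M <#> H)) (q ^ multiplicity q (order G) * card (M <#> H))"
        by simp
      also have "\<dots> = card (M <#> H)"
      proof -
        have "gcd (p ^ k) (q ^ multiplicity q (order G)) = 1"
          using False p q primes_coprime[of p q] by (simp flip: coprime_iff_gcd_eq_1)
        then show ?thesis
          using gcd_mult_distrib_nat[of "card (M <#> H)" "p ^ k" "q ^ multiplicity q (order G)"]
          by (simp add: mult.commute)
      qed
      finally have "card ?U \<le> card (M <#> H)"
        using card_subgroup_pos[OF sMH fin] by (simp add: dvd_imp_le)
      then have U: "M <#> H = ?U"
        using MHU fin subgroup.subset[OF sU] by (metis card_seteq finite_subset)
      have KX: "?K = ?X \<inter> N"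
        using U subset_set_mult(1)[OF N.subgroup_axioms sH] by blast
      have "Q \<subseteq> normalizer G ?K"
      proof
        fix g assume g: "g \<in> Q"
        have gc: "g \<in> carrier G" using g subgroup.mem_carrier[OF sQ] by blast
        have "g \<otimes> x \<otimes> inv g \<in> ?X \<inter> N" if x: "x \<in> ?X \<inter> N" for x
          using x g gc HX subgroup.m_closed[OF sX] subgroup.m_inv_closed[OF sX] N.inv_op_closed2
          by (meson IntD1 IntD2 IntI subsetD)
        then show "g \<in> normalizer G ?K"
          unfolding KX using gc normalizer_iff[OF Kc[unfolded KX] fin] by simp
      qed
      then show ?thesis using Q by blast
    qed
  qed
  then show ?thesis using sK normalizer_iff[OF Kc fin] by (auto simp: normal_inv_iff)
qed


text \<open>MD and D have the same image in G/M, and homomorphisms carry derived subgroups to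
  derived subgroups of images.\<close>

lemma derived_normal_mult_subset:
  assumes M: "M \<lhd> G" and D: "subgroup D G"
  shows "derived G (M <#> D) \<subseteq> M <#> derived G D"
proof -
  interpret M: normal M G by (rule M)
  interpret Q: group "G Mod M" by (rule M.factorgroup_is_group)
  interpret \<pi>: group_hom G "G Mod M" "(#>) M"
    by unfold_locales (rule M.r_coset_hom_Mod)
  have sMD: "M <#> D \<subseteq> carrier G"
    using M.subset subgroup.subset[OF D] by (rule setmult_subset_G)
  have sdD: "subgroup (derived G D) G" using derived_is_subgroup[OF subgroup.subset[OF D]] .
  have "(#>) M ` (M <#> D) = (#>) M ` D"
  proof
    show "(#>) M ` (M <#> D) \<subseteq> (#>) M ` D"
    proof
      fix y assume "y \<in> (#>) M ` (M <#> D)"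
      then obtain m d where md: "m \<in> M" "d \<in> D" "y = M #> (m \<otimes> d)" unfolding set_mult_def by blast
      have "M #> (m \<otimes> d) = M #> d"
        using md subgroup.mem_carrier[OF D] rcos_eq_iff[OF M.subgroup_axioms, of "m \<otimes> d" d]
        by (simp add: group_normalize)
      then show "y \<in> (#>) M ` D" using md by blast
    qed
    show "(#>) M ` D \<subseteq> (#>) M ` (M <#> D)"
      using subset_set_mult(2)[OF M.subgroup_axioms D] by (rule image_mono)
  qed
  then have eq: "(#>) M ` derived G (M <#> D) = (#>) M ` derived G D"
    using \<pi>.derived_img[OF sMD] \<pi>.derived_img[OF subgroup.subset[OF D]] by simp
  show ?thesis
  proof
    fix x assume x: "x \<in> derived G (M <#> D)"
    then have xc: "x \<in> carrier G" using derived_in_carrier[OF sMD] by blast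
    obtain d where d: "d \<in> derived G D" "M #> x = M #> d" using x eq by blast
    have dc: "d \<in> carrier G" using d subgroup.mem_carrier[OF sdD] by blast
    have "x \<otimes> inv d \<in> M" using d rcos_eq_iff[OF M.subgroup_axioms xc dc] by simp
    moreover have "x = (x \<otimes> inv d) \<otimes> d" using xc dc by (simp add: group_normalize)
    ultimately show "x \<in> M <#> derived G D" using d(1) unfolding set_mult_def by blast
  qed
qed

text \<open>The index of E in D divides |D|/|M| = p^k. This supplies the coprimality for both uses
  of the complement theorem.\<close>

lemma coprime_sections:
  assumes p: "Factorial_Ring.prime p" and fin: "finite (carrier G)"
    and E: "subgroup E G" and D: "subgroup D G" and ED: "E \<subseteq> D"
    and ME: "card M dvd card E" and cD: "card D = p ^ k * card M" and m: "\<not> p dvd m"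
  shows "coprime (card D div card E) m"
proof -
  have E0: "card E \<noteq> 0" using card_subgroup_pos[OF E fin] by simp
  obtain i where i: "card D = card E * i" using card_subgroup_dvd[OF E D ED] by (elim dvdE)
  obtain j where j: "card E = card M * j" using ME by (elim dvdE)
  have "card M * p ^ k = card M * (j * i)" using i j cD by (simp add: ac_simps)
  then have "i dvd p ^ k" using E0 j by (auto simp: mult.commute)
  moreover have "coprime (p ^ k) m" using p m by (simp add: prime_imp_coprime)
  ultimately have "coprime i m" using coprime_divisors[of i "p ^ k" m m] by simp
  then show ?thesis using i E0 by simp
qed

section \<open>Normality of P modulo a normal p'-subgroup\<close>

lemma finite_normal_subgroups:
  assumes "finite (carrier G)"
  shows "finite {U. U \<lhd> G \<and> R U}"
proof (rule finite_subset)
  show "{U. U \<lhd> G \<and> R U} \<subseteq> Pow (carrier G)"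
    using subgroup.subset[OF normal_imp_subgroup] by blast
  show "finite (Pow (carrier G))" using assms by simp
qed

lemma obtain_maximal_normal:
  assumes "finite (carrier G)" "Y \<lhd> G" "R Y"
  obtains U where "U \<lhd> G" "R U" "\<And>Z. Z \<lhd> G \<Longrightarrow> R Z \<Longrightarrow> U \<subseteq> Z \<Longrightarrow> Z = U"
proof -
  have "{U. U \<lhd> G \<and> R U} \<noteq> {}" using assms by blast
  from finite_has_maximal[OF finite_normal_subgroups[OF assms(1)] this] that
  show thesis by auto
qed

lemma obtain_minimal_normal:
  assumes "finite (carrier G)" "Y \<lhd> G" "R Y"
  obtains U where "U \<lhd> G" "R U" "\<And>Z. Z \<lhd> G \<Longrightarrow> R Z \<Longrightarrow> Z \<subseteq> U \<Longrightarrow> Z = U"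
proof -
  have "{U. U \<lhd> G \<and> R U} \<noteq> {}" using assms by blast
  from finite_has_minimal[OF finite_normal_subgroups[OF assms(1)] this] that
  show thesis by auto
qed

text \<open>Such an M shows that G has p-length at most one: M is a p'-group, MP/M a p-group and
  G/MP a p'-group.\<close>

theorem sylow_normal_modulo_coprime_normal:
  assumes fin: "finite (carrier G)" and p: "Factorial_Ring.prime p" and psol: "p_solvable p G"
    and P: "sylow_subgroup G p P"
    and H: "s_semipermutable H G" and PH: "derived G P \<subseteq> H"
    and HF: "H \<subseteq> frattini (G\<lparr>carrier := P\<rparr>)"
  obtains M where "M \<lhd> G" "\<not> p dvd card M" "M <#> P \<lhd> G"
proof -
  have sP: "subgroup P G" and cP: "card P = p ^ multiplicity p (order G)"
    and sH: "subgroup H G"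
    using P H by (auto simp: sylow_subgroup_def s_semipermutable_def)
  have HP: "H \<subseteq> P" using HF unfolding frattini_def by auto
  have "\<not> p dvd card {\<one>}" using p by (simp add: prime_nat_iff)
  then obtain M where M: "M \<lhd> G" "\<not> p dvd card M"
    and maxM: "\<And>U. U \<lhd> G \<Longrightarrow> \<not> p dvd card U \<Longrightarrow> M \<subseteq> U \<Longrightarrow> U = M"
    using obtain_maximal_normal[OF fin one_is_normal, of "\<lambda>U. \<not> p dvd card U"] by metis
  interpret M: normal M G by (rule M)
  note sM = M.subgroup_axioms
  have "M \<subseteq> M \<and> (\<exists>k. card M = p ^ k * card M)" by (metis mult_1 order_refl power_0)
  then obtain N where N: "N \<lhd> G" "M \<subseteq> N" "\<exists>k. card N = p ^ k * card M"
    and maxN: "\<And>U. U \<lhd> G \<Longrightarrow> M \<subseteq> U \<Longrightarrow> \<exists>k. card U = p ^ k * card M \<Longrightarrow> N \<subseteq> U \<Longrightarrow> U = N"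
    using obtain_maximal_normal[OF fin M(1), of "\<lambda>U. M \<subseteq> U \<and> (\<exists>k. card U = p ^ k * card M)"] by metis
  interpret N: normal N G by (rule N)
  note sN = N.subgroup_axioms
  obtain k where k: "card N = p ^ k * card M" using N(3) by blast
  have MP: "M \<inter> P = {\<one>}"
    using coprime_Int_trivial[OF sM sP _ fin] cP M(2) p
    by (simp add: coprime_commute prime_imp_coprime)
  have NMP: "N = M <#> (P \<inter> N)"
    by (rule eq_set_mult_Int_sylow[OF fin p P M N(1,2) k])
  define K where "K = (M <#> H) \<inter> N"
  have sMH: "subgroup (M <#> H) G" by (rule mult_norm_subgroup[OF M(1) sH])
  have nK: "K \<lhd> G"
    unfolding K_def by (rule s_semipermutable_core_normal[OF fin p P H HP PH M N(1,2) k])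
  interpret K: normal K G by (rule nK)
  note sK = K.subgroup_axioms
  have KN: "K \<subseteq> N" by (simp add: K_def)
  have MK: "M \<subseteq> K" unfolding K_def using subset_set_mult(1)[OF sM sH] N(2) by blast
  define C where "C = {g \<in> carrier G. \<forall>s\<in>N. g \<otimes> s \<otimes> inv g \<otimes> inv s \<in> K}"
  have nC: "C \<lhd> G" unfolding C_def by (rule centralizer_mod_normal[OF nK N(1)])
  note sC = normal_imp_subgroup[OF nC]
  have MC: "M \<subseteq> C"
  proof
    fix g assume g: "g \<in> M"
    have "g \<otimes> (s \<otimes> inv g \<otimes> inv s) \<in> K" if "s \<in> N" for s
    proof (rule K.m_closed)
      show "g \<in> K" using g MK by blast
      show "s \<otimes> inv g \<otimes> inv s \<in> K"
        using M.inv_op_closed2[of s "inv g"] g that MK by auto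
    qed
    then show "g \<in> C" using g by (simp add: C_def group_normalize)
  qed
  have PC: "P \<subseteq> C"
  proof
    fix x assume x: "x \<in> P"
    have xc: "x \<in> carrier G" using x subgroup.mem_carrier[OF sP] by blast
    have "x \<otimes> s \<otimes> inv x \<otimes> inv s \<in> K" if s: "s \<in> N" for s
    proof -
      \<comment> \<open>[x, my] = (x m x^-1) [x,y] m^-1, and the middle factor lies in P' \<le>
        H.\<close>
      obtain m y where my: "m \<in> M" "y \<in> P" "s = m \<otimes> y"
        using s NMP unfolding set_mult_def by blast
      have yc: "y \<in> carrier G" using my subgroup.mem_carrier[OF sP] by blast
      have MMH: "M \<subseteq> M <#> H" "H \<subseteq> M <#> H" using subset_set_mult[OF sM sH] by auto
      have "x \<otimes> y \<otimes> inv x \<otimes> inv y \<in> derived G P"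
        unfolding derived_def using x my by (intro generate.incl) blast
      then have "(x \<otimes> m \<otimes> inv x) \<otimes> (x \<otimes> y \<otimes> inv x \<otimes> inv y) \<otimes> inv m \<in> M <#> H"
        using PH MMH M.inv_op_closed2[OF xc my(1)] M.m_inv_closed[OF my(1)]
        by (meson subgroup.m_closed[OF sMH] subsetD)
      also have "(x \<otimes> m \<otimes> inv x) \<otimes> (x \<otimes> y \<otimes> inv x \<otimes> inv y) \<otimes> inv m = x \<otimes> s \<otimes> inv x \<otimes> inv s"
        using xc yc my by (simp add: group_normalize)
      finally have "x \<otimes> s \<otimes> inv x \<otimes> inv s \<in> M <#> H" .
      moreover have "x \<otimes> s \<otimes> inv x \<otimes> inv s \<in> N"
        by (rule N.m_closed[OF N.inv_op_closed2[OF xc s] N.m_inv_closed[OF s]])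
      ultimately show ?thesis by (simp add: K_def)
    qed
    then show "x \<in> C" using xc by (simp add: C_def)
  qed
  have NC: "N \<subseteq> C"
    by (subst NMP) (use set_mult_subset[OF sC MC] PC in blast)
  have "C \<subseteq> N"
  proof (rule ccontr)
    assume "\<not> C \<subseteq> N"
    then have "N \<subset> C \<and> C \<subseteq> C" using NC by blast
    then obtain L where L: "L \<lhd> G" "N \<subset> L" "L \<subseteq> C"
      and minL: "\<And>U. U \<lhd> G \<Longrightarrow> N \<subset> U \<Longrightarrow> U \<subseteq> C \<Longrightarrow> U \<subseteq> L \<Longrightarrow> U = L"
      using obtain_minimal_normal[OF fin nC, of "\<lambda>U. N \<subset> U \<and> U \<subseteq> C"] by metis
    note sL = normal_imp_subgroup[OF L(1)]
    have "chief_factor G L N"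
      unfolding chief_factor_def using L N(1) minL by blast
    \<comment> \<open>Otherwise L would contradict the maximality of N. This excludes the first
      alternative in the definition of p-solvability.\<close>
    moreover have "\<not> (\<exists>n. card L = p ^ n * card N)"
    proof
      assume "\<exists>n. card L = p ^ n * card N"
      then have "\<exists>n. card L = p ^ n * card M" using k by (metis mult.assoc power_add)
      then show False using maxN[OF L(1)] L(2) N(2) by blast
    qed
    ultimately have pLN: "\<not> p dvd card L div card N"
      using psol unfolding p_solvable_def by blast
    have cN0: "card N \<noteq> 0" using card_subgroup_pos[OF sN fin] by simp
    obtain W where W: "subgroup W G" "K \<subseteq> W" "W \<subseteq> L" "N \<inter> W = K" "L \<subseteq> N <#> W"
      and Wconj: "\<And>g. g \<in> carrier G \<Longrightarrow> \<exists>d\<in>N. \<forall>w\<in>W. (d \<otimes> g) \<otimes> w \<otimes> inv (d \<otimes> g) \<in> W"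
    proof (rule abelian_section_complement[OF fin nK N(1) L(1) KN])
      show "N \<subseteq> L" using L by blast
      \<comment> \<open>N lies in the centralizer C of N/K, so N/K is abelian.\<close>
      show "a \<otimes> b \<otimes> inv a \<otimes> inv b \<in> K" if "a \<in> N" "b \<in> N" for a b
        using that NC unfolding C_def by blast
      show "coprime (card N div card K) (card L div card N)"
        using coprime_sections[OF p fin sK sN KN card_subgroup_dvd[OF sM sK MK] k pLN] .
    qed blast
    \<comment> \<open>Some d in N makes dg normalize W. As W lies in C, conjugation by d changes
      elements of W only by factors in K \<le> W, so g normalizes W as well.\<close>
    have nW: "W \<lhd> G"
      unfolding normal_inv_iff
    proof (intro conjI ballI W(1))
      fix g w assume g: "g \<in> carrier G" and w: "w \<in> W"
      obtain d where d: "d \<in> N" "(d \<otimes> g) \<otimes> w \<otimes> inv (d \<otimes> g) \<in> W" using Wconj[OF g] w by blast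
      let ?w = "(d \<otimes> g) \<otimes> w \<otimes> inv (d \<otimes> g)"
      have wc: "w \<in> carrier G" "?w \<in> carrier G" using w d W(1) subgroup.mem_carrier by metis+
      have "?w \<in> C" using d W L by blast
      then have "?w \<otimes> d \<otimes> inv ?w \<otimes> inv d \<in> K" using d unfolding C_def by blast
      then have "inv d \<otimes> (?w \<otimes> d \<otimes> inv ?w \<otimes> inv d) \<otimes> d \<in> W"
        using K.inv_op_closed1[OF N.mem_carrier[OF d(1)]] W(2) by (meson subsetD)
      then have "inv d \<otimes> (?w \<otimes> d \<otimes> inv ?w \<otimes> inv d) \<otimes> d \<otimes> ?w \<in> W"
        using d(2) by (rule subgroup.m_closed[OF W(1)])
      then show "g \<otimes> w \<otimes> inv g \<in> W" using g wc(1) d by (simp add: group_normalize)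
    qed
    \<comment> \<open>V is the complement obtained so far and D the part of N that it still
      contains. Taking D minimal replaces an induction along the derived series: if D is larger than
      M it can be shrunk, and D = M is impossible.\<close>
    define good where "good D \<longleftrightarrow> M \<subseteq> D \<and> D \<subseteq> K \<and>
      (\<exists>V. V \<lhd> G \<and> D \<subseteq> V \<and> V \<subseteq> L \<and> V \<inter> N = D \<and> L \<subseteq> N <#> V)" for D
    have "good K"
      unfolding good_def using nW W MK by (intro conjI exI[of _ W]) auto
    then obtain D where D: "D \<lhd> G" "good D"
      and minD: "\<And>U. U \<lhd> G \<Longrightarrow> good U \<Longrightarrow> U \<subseteq> D \<Longrightarrow> U = D"
      using obtain_minimal_normal[OF fin nK, of good] by metis
    then obtain V where MD: "M \<subseteq> D" and DK: "D \<subseteq> K" and V: "V \<lhd> G" and DV: "D \<subseteq> V"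
      and VL: "V \<subseteq> L" and VN: "V \<inter> N = D" and LNV: "L \<subseteq> N <#> V"
      unfolding good_def by blast
    note sD = normal_imp_subgroup[OF D(1)] and sV = normal_imp_subgroup[OF V]
    have cD0: "card D \<noteq> 0" using card_subgroup_pos[OF sD fin] by simp
    \<comment> \<open>Since NV = L and V \<inter> N = D, the section V/D has the order of L/N, which
      is prime to p.\<close>
    have "N <#> V = L" using LNV set_mult_subset[OF sL] L VL by blast
    then have "card L * card D = card N * card V"
      using card_set_mult[OF sN sV] VN by (simp add: Int_commute)
    moreover obtain l where l: "card L = card N * l"
      using card_subgroup_dvd[OF sN sL] L by (auto elim: dvdE)
    ultimately have cV: "card V = card D * l" using cN0 by (simp add: mult.commute)
    then have VD: "card V div card D = card L div card N" using l cN0 cD0 by simp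
    have pl: "\<not> p dvd l" using pLN l cN0 by simp
    have DN: "D \<subseteq> N" using DK KN by blast
    obtain k' where k': "card D = p ^ k' * card M"
    proof -
      obtain i where i: "card D = card M * i" using card_subgroup_dvd[OF sM sD MD] by (elim dvdE)
      obtain j where "card N = card D * j" using card_subgroup_dvd[OF sD sN DN] by (elim dvdE)
      then have "card M * p ^ k = card M * (i * j)" using k i by (simp add: ac_simps)
      then have "i dvd p ^ k" using cD0 i by auto
      then obtain k' where "i = p ^ k'" using p divides_primepow_nat by blast
      then show thesis using that[of k'] i by (simp add: mult.commute)
    qed
    define D0 where "D0 = P \<inter> D"
    have sD0: "subgroup D0 G" unfolding D0_def using sP sD subgroups_Inter_pair by blast
    have DMD0: "D = M <#> D0"
      unfolding D0_def by (rule eq_set_mult_Int_sylow[OF fin p P M D(1) MD k'])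
    \<comment> \<open>D \<le> MH gives x = m h, and m = x h^-1 lies in M \<inter> P = 1. So D0 ends
      up in the Frattini subgroup of P.\<close>
    have D0H: "D0 \<subseteq> H"
    proof
      fix x assume x: "x \<in> D0"
      then have "x \<in> M <#> H" using DK unfolding D0_def K_def by blast
      then obtain m h where mh: "m \<in> M" "h \<in> H" "x = m \<otimes> h" unfolding set_mult_def by blast
      then have hP: "h \<in> P" "h \<in> carrier G" using HP subgroup.mem_carrier[OF sH] by auto
      have "x \<otimes> inv h \<in> P" using x hP subgroup.m_closed[OF sP] subgroup.m_inv_closed[OF sP]
        unfolding D0_def by blast
      moreover have "x \<otimes> inv h = m" using mh hP by (simp add: group_normalize)
      ultimately have "m = \<one>" using MP mh by blast
      then show "x \<in> H" using mh hP by simp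
    qed
    \<comment> \<open>The next term of the descent: D/E is abelian, and adding M keeps E above
      M.\<close>
    define E where "E = M <#> derived G D"
    have nE: "E \<lhd> G"
      unfolding E_def using M(1) derived_is_normal[OF D(1)] by (rule normal_subgroup_set_mult_closed)
    have sE: "subgroup E G" by (rule normal_imp_subgroup[OF nE])
    have sdD: "subgroup (derived G D) G" by (rule derived_is_subgroup[OF subgroup.subset[OF sD]])
    have ED: "E \<subseteq> D"
      unfolding E_def using set_mult_subset[OF sD MD] derived_incl[OF _ sD] by blast
    have ME: "M \<subseteq> E" and dE: "derived G D \<subseteq> E"
      unfolding E_def using subset_set_mult[OF sM sdD] by auto
    show False
    proof (cases "E = D")
      \<comment> \<open>From D = M D' follows D0 = D0', so the p-group D0 is trivial and D = M. Then
        |V| = |M| l is prime to p, the choice of M gives V = M, and L = NV collapses to N.\<close>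
      case True
      have sdD0: "subgroup (derived G D0) G" by (rule derived_is_subgroup[OF subgroup.subset[OF sD0]])
      have dD0: "derived G D0 \<subseteq> D0" by (rule derived_incl[OF _ sD0]) blast
      have sMd: "subgroup (M <#> derived G D0) G" by (rule mult_norm_subgroup[OF M(1) sdD0])
      have "derived G D \<subseteq> M <#> derived G D0"
        using derived_normal_mult_subset[OF M(1) sD0] DMD0 by simp
      then have "E \<subseteq> M <#> derived G D0"
        unfolding E_def using subset_set_mult(1)[OF sM sdD0] by (intro set_mult_subset[OF sMd])
      have "D0 \<subseteq> derived G D0"
      proof
        fix x assume x: "x \<in> D0"
        then have "x \<in> M <#> derived G D0"
          using True \<open>E \<subseteq> M <#> derived G D0\<close> unfolding D0_def by blast
        then obtain m y where my: "m \<in> M" "y \<in> derived G D0" "x = m \<otimes> y" unfolding set_mult_def by blast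
        have yc: "y \<in> D0" "y \<in> carrier G" using my dD0 subgroup.mem_carrier[OF sdD0] by auto
        have "x \<otimes> inv y \<in> P"
          using x yc subgroup.m_closed[OF sP] subgroup.m_inv_closed[OF sP] unfolding D0_def by blast
        moreover have "x \<otimes> inv y = m" using my yc by (simp add: group_normalize)
        ultimately have "m = \<one>" using MP my by blast
        then show "x \<in> derived G D0" using my yc by simp
      qed
      then have "derived G D0 = D0" using dD0 by blast
      moreover have "card D0 = p ^ multiplicity p (card D)"
        unfolding D0_def by (rule card_Int_sylow_normal[OF fin p P D(1)])
      ultimately have "D0 = {\<one>}" using p_subgroup_derived_proper[OF fin p sD0] by blast
      then have "D = M" using DMD0 M.subset by (auto simp: set_mult_def)
      then have "\<not> p dvd card V" using cV M(2) pl p by (simp add: prime_dvd_mult_iff)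
      then have "V = M" using maxM[OF V] DV \<open>D = M\<close> by blast
      then have "L \<subseteq> N" using LNV set_mult_subset[OF sN, of N V] N(2) by blast
      then show False using L by blast
    next
      case False
      obtain W where W: "subgroup W G" "E \<subseteq> W" "W \<subseteq> V" "D \<inter> W = E" "V \<subseteq> D <#> W"
        and Wconj: "\<And>g. g \<in> carrier G \<Longrightarrow> \<exists>d\<in>D. \<forall>w\<in>W. (d \<otimes> g) \<otimes> w \<otimes> inv (d \<otimes> g) \<in> W"
      proof (rule abelian_section_complement[OF fin nE D(1) V ED DV])
        show "a \<otimes> b \<otimes> inv a \<otimes> inv b \<in> E" if "a \<in> D" "b \<in> D" for a b
          using that dE unfolding derived_def by (blast intro: generate.incl)
        show "coprime (card D div card E) (card V div card D)"
          unfolding VD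
          using coprime_sections[OF p fin sE sD ED card_subgroup_dvd[OF sM sE ME] k' pLN] .
      qed blast
      note Wc = subgroup.subset[OF W(1)]
      let ?NW = "normalizer G W"
      have sNW: "subgroup ?NW G" by (rule normalizer_imp_subgroup[OF Wc])
      have NWI: "\<exists>d\<in>D. d \<otimes> g \<in> ?NW" if g: "g \<in> carrier G" for g
        using Wconj[OF g] g normalizer_iff[OF Wc fin] by (metis subgroup.mem_carrier[OF sD] m_closed)
      have WNW: "W \<subseteq> ?NW"
        using Wc subgroup.m_closed[OF W(1)] subgroup.m_inv_closed[OF W(1)]
        by (auto simp: normalizer_iff[OF Wc fin])
      then have MNW: "M \<subseteq> ?NW" using ME W(2) by blast
      have sPN: "subgroup (P \<inter> ?NW) G" using sP sNW subgroups_Inter_pair by blast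
      \<comment> \<open>For x in P some d in D = M D0 has d x in N(W). As M \<le> W normalizes W, d
        may be replaced by its factor in D0 \<le> P. So P = D0 (P \<inter> N(W)), and D0 consists of
        nongenerators.\<close>
      have "P \<inter> ?NW = P"
      proof (rule frattini_nongenerator[OF fin sP sPN])
        show "D0 \<subseteq> frattini (G\<lparr>carrier := P\<rparr>)" using D0H HF by blast
        show "P \<subseteq> D0 <#> (P \<inter> ?NW)"
        proof
          fix x assume x: "x \<in> P"
          have xc: "x \<in> carrier G" using x subgroup.mem_carrier[OF sP] by blast
          obtain d where d: "d \<in> D" "d \<otimes> x \<in> ?NW" using NWI[OF xc] by blast
          then obtain m y where my: "m \<in> M" "y \<in> D0" "d = m \<otimes> y" using DMD0 unfolding set_mult_def by blast
          have yc: "y \<in> carrier G" "y \<in> P" using my subgroup.mem_carrier[OF sD0] unfolding D0_def by auto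
          have "inv m \<otimes> (d \<otimes> x) \<in> ?NW"
            using d my MNW subgroup.m_closed[OF sNW] subgroup.m_inv_closed[OF sNW] by blast
          then have "y \<otimes> x \<in> ?NW" using my xc yc by (simp add: group_normalize)
          moreover have "y \<otimes> x \<in> P" using x yc subgroup.m_closed[OF sP] by blast
          moreover have "inv y \<in> D0" using my subgroup.m_inv_closed[OF sD0] by blast
          moreover have "x = inv y \<otimes> (y \<otimes> x)" using xc yc by (simp add: group_normalize)
          ultimately show "x \<in> D0 <#> (P \<inter> ?NW)" unfolding set_mult_def by blast
        qed
      qed blast
      then have "D0 \<subseteq> ?NW" unfolding D0_def by blast
      then have DNW: "D \<subseteq> ?NW" by (subst DMD0) (rule set_mult_subset[OF sNW MNW])
      \<comment> \<open>With D \<le> N(W), the equation G = D N(W) becomes G = N(W).\<close>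
      have "g \<in> ?NW" if g: "g \<in> carrier G" for g
      proof -
        obtain d where d: "d \<in> D" "d \<otimes> g \<in> ?NW" using NWI[OF g] by blast
        then have "inv d \<otimes> (d \<otimes> g) \<in> ?NW"
          using DNW subgroup.m_closed[OF sNW] subgroup.m_inv_closed[OF sNW] by blast
        then show ?thesis using subgroup.mem_carrier[OF sD d(1)] g by (simp add: group_normalize)
      qed
      then have nW: "W \<lhd> G" using W(1) normalizer_iff[OF Wc fin] by (simp add: normal_inv_iff)
      have "L \<subseteq> N <#> W"
      proof
        fix x assume "x \<in> L"
        then obtain n v where nv: "n \<in> N" "v \<in> V" "x = n \<otimes> v" using LNV unfolding set_mult_def by blast
        then obtain d w where dw: "d \<in> D" "w \<in> W" "v = d \<otimes> w" using W(5) unfolding set_mult_def by blast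
        have "n \<otimes> d \<in> N" using nv dw DN by blast
        moreover have "x = (n \<otimes> d) \<otimes> w" 
          using nv dw subgroup.mem_carrier[OF sD] subgroup.mem_carrier[OF W(1)] by (simp add: m_assoc)
        ultimately show "x \<in> N <#> W" using dw unfolding set_mult_def by blast
      qed
      then have "good E"
        unfolding good_def using ME ED DK nW W VL VN by (intro conjI exI[of _ W]) auto
      then show False using minD[OF nE _ ED] False by blast
    qed
  qed
  then have "P \<subseteq> N" using PC by blast
  then have "M <#> P = N" using NMP by (simp add: Int_absorb2)
  then show thesis using that M N by simp
qed

end

subsection \<open>The Frattini argument and chief factors\<close>

context group
begin

lemma conj_image_subgroup:
  assumes P: "subgroup P G" and g: "g \<in> carrier G"
  shows "subgroup ((\<lambda>x. g \<otimes> x \<otimes> inv g) ` P) G" "card ((\<lambda>x. g \<otimes> x \<otimes> inv g) ` P) = card P"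
proof -
  have "(\<lambda>x. g \<otimes> x \<otimes> inv g) \<in> hom G G"
    using g by (intro homI) (simp_all add: group_normalize)
  then interpret c: group_hom G G "\<lambda>x. g \<otimes> x \<otimes> inv g"
    by unfold_locales
  show "subgroup ((\<lambda>x. g \<otimes> x \<otimes> inv g) ` P) G" by (rule c.subgroup_img_is_subgroup[OF P])
  have "inj_on (\<lambda>x. g \<otimes> x \<otimes> inv g) P"
    using g subgroup.mem_carrier[OF P] by (intro inj_onI) (metis inv_closed m_closed r_cancel l_cancel)
  then show "card ((\<lambda>x. g \<otimes> x \<otimes> inv g) ` P) = card P" by (rule card_image)
qed

lemma frattini_argument:
  assumes fin: "finite (carrier G)" and p: "Factorial_Ring.prime p"
    and P: "sylow_subgroup G p P" and M: "M \<lhd> G" and pM: "\<not> p dvd card M"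
    and N: "M <#> P \<lhd> G"
  shows "carrier G = M <#> normalizer G P"
proof
  have sP: "subgroup P G" and cP: "card P = p ^ multiplicity p (order G)"
    using P by (auto simp: sylow_subgroup_def)
  let ?N = "M <#> P" and ?A = "normalizer G P"
  interpret M: normal M G by (rule M)
  note sM = M.subgroup_axioms and sN = normal_imp_subgroup[OF N]
  note Pc = subgroup.subset[OF sP]
  have sA: "subgroup ?A G" by (rule normalizer_imp_subgroup[OF Pc])
  have PA: "P \<subseteq> ?A"
    using Pc subgroup.m_closed[OF sP] subgroup.m_inv_closed[OF sP]
    by (auto simp: normalizer_iff[OF Pc fin])
  have PN: "P \<subseteq> ?N" by (rule subset_set_mult(2)[OF sM sP])
  interpret N: group "G\<lparr>carrier := ?N\<rparr>" by (rule subgroup_imp_group[OF sN])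
  have "coprime (card M) (card P)"
    unfolding cP using p pM by (simp add: coprime_commute prime_imp_coprime)
  then have cN: "card ?N = card M * card P"
    using card_Int_set_mult_trivial[OF sM sP] coprime_Int_trivial[OF sM sP _ fin] by simp
  have sPN: "subgroup P (G\<lparr>carrier := ?N\<rparr>)" by (rule subgroup_incl[OF sP sN PN])
  have "card (rcosets\<^bsub>G\<lparr>carrier := ?N\<rparr>\<^esub> P) * card P = card M * card P"
    using N.lagrange[OF sPN] cN by (simp add: order_def)
  then have idx: "card (rcosets\<^bsub>G\<lparr>carrier := ?N\<rparr>\<^esub> P) = card M"
    using card_subgroup_pos[OF sP fin] by simp
  show "carrier G \<subseteq> M <#> ?A"
  proof
    fix g assume g: "g \<in> carrier G"
    let ?Q = "(\<lambda>x. g \<otimes> x \<otimes> inv g) ` P"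
    have QN: "?Q \<subseteq> ?N" using PN g normal.inv_op_closed2[OF N g] by blast
    have sQ: "subgroup ?Q (G\<lparr>carrier := ?N\<rparr>)"
      by (rule subgroup_incl[OF conj_image_subgroup(1)[OF sP g] sN QN])
    have finN: "finite (carrier (G\<lparr>carrier := ?N\<rparr>))"
      using fin subgroup.subset[OF sN] finite_subset by auto
    have cQ: "card ?Q = p ^ multiplicity p (order G)"
      using conj_image_subgroup(2)[OF sP g] cP by simp
    have "\<not> p dvd card (rcosets\<^bsub>G\<lparr>carrier := ?N\<rparr>\<^esub> P)" using idx pM by simp
    from N.p_subgroup_conj_in[OF finN p sQ cQ sPN this]
    obtain n where n: "n \<in> ?N" and "\<And>q. q \<in> ?Q \<Longrightarrow> n \<otimes> q \<otimes> inv\<^bsub>G\<lparr>carrier := ?N\<rparr>\<^esub> n \<in> P"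
      by auto
    then have nQ: "n \<otimes> (g \<otimes> x \<otimes> inv g) \<otimes> inv n \<in> P" if "x \<in> P" for x
      using that m_inv_consistent[OF sN n] by auto
    have nc: "n \<in> carrier G" using n subgroup.mem_carrier[OF sN] by blast
    have "n \<otimes> g \<otimes> x \<otimes> inv (n \<otimes> g) \<in> P" if x: "x \<in> P" for x
      using nQ[OF x] nc g subgroup.mem_carrier[OF sP x] by (simp add: group_normalize)
    then have ng: "n \<otimes> g \<in> ?A" using nc g by (simp add: normalizer_iff[OF Pc fin])
    have "n \<in> P <#> M" using n commut_normal[OF sP M] by simp
    then obtain y m where ym: "y \<in> P" "m \<in> M" "n = y \<otimes> m" unfolding set_mult_def by blast
    have yc: "y \<in> carrier G" using ym Pc by blast
    have "inv y \<otimes> (n \<otimes> g) \<in> ?A"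
      using PA ng ym subgroup.m_closed[OF sA] subgroup.m_inv_closed[OF sA] by (meson subsetD)
    then have "m \<otimes> g \<in> ?A" using ym yc g by (simp add: group_normalize)
    moreover have "g = inv m \<otimes> (m \<otimes> g)" using ym g by (simp add: group_normalize)
    moreover have "inv m \<in> M" using ym by simp
    ultimately show "g \<in> M <#> ?A" unfolding set_mult_def by blast
  qed
  show "M <#> ?A \<subseteq> carrier G"
    using M.subset subgroup.subset[OF sA] by (rule setmult_subset_G)
qed

text \<open>A chief factor of order divisible by \<open>p\<close> survives in the quotient by the \<open>p'\<close>-group \<open>M\<close>,
  and \<open>A\<close> covers that quotient.\<close>

lemma p_supersolvable_normal_mult:
  assumes fin: "finite (carrier G)" and p: "Factorial_Ring.prime p"
    and M: "M \<lhd> G" and pM: "\<not> p dvd card M"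
    and A: "subgroup A G" and GMA: "carrier G = M <#> A"
    and ss: "p_supersolvable p (G\<lparr>carrier := A\<rparr>)"
  shows "p_supersolvable p G"
  unfolding p_supersolvable_def
proof (intro allI impI)
  fix R S assume cf: "chief_factor G R S" and pd: "p dvd card R div card S"
  have S: "S \<lhd> G" and R: "R \<lhd> G" and SR: "S \<subset> R"
    and minimal: "\<And>U. U \<lhd> G \<Longrightarrow> S \<subseteq> U \<Longrightarrow> U \<subseteq> R \<Longrightarrow> U = S \<or> U = R"
    using cf unfolding chief_factor_def by blast+
  note sM = normal_imp_subgroup[OF M] and sS = normal_imp_subgroup[OF S] and sR = normal_imp_subgroup[OF R]
  have S0: "card S > 0" by (rule card_subgroup_pos[OF sS fin])
  obtain l where l: "card R = card S * l" using card_subgroup_dvd[OF sS sR] SR by (auto elim: dvdE)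
  have pl: "p dvd l" using pd l S0 by simp
  have nRM: "R \<inter> M \<lhd> G" by (rule normal_subgroup_intersect[OF R M])
  note sRM = normal_imp_subgroup[OF nRM]
  \<comment> \<open>If M covered R/S, the order l of R/S, a multiple of p, would divide |R \<inter>
    M| and hence |M|. By minimality of the chief factor, R \<inter> M then lies in S.\<close>
  have "S <#> (R \<inter> M) \<noteq> R"
  proof
    assume "S <#> (R \<inter> M) = R"
    then have "card R * card (S \<inter> (R \<inter> M)) = card S * card (R \<inter> M)"
      using card_set_mult[OF sS sRM] by simp
    then have "card (R \<inter> M) = l * card (S \<inter> (R \<inter> M))" using l S0 by simp
    then have "p dvd card (R \<inter> M)" using pl by simp
    also have "card (R \<inter> M) dvd card M" by (rule card_subgroup_dvd[OF sRM sM]) blast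
    finally show False using pM by blast
  qed
  moreover have "S \<subseteq> S <#> (R \<inter> M)" "S <#> (R \<inter> M) \<subseteq> R"
    using subset_set_mult[OF sS sRM] set_mult_subset[OF sR] SR by auto
  ultimately have "S <#> (R \<inter> M) = S"
    using minimal[OF normal_subgroup_set_mult_closed[OF S nRM]] by blast
  then have RMS: "M \<inter> R = M \<inter> S"
    using subset_set_mult(2)[OF sS sRM] SR by blast
  define RM where "RM = M <#> R"
  define SM where "SM = M <#> S"
  have nRM': "RM \<lhd> G" and nSM: "SM \<lhd> G"
    unfolding RM_def SM_def by (rule normal_subgroup_set_mult_closed[OF M R] normal_subgroup_set_mult_closed[OF M S])+
  note sRM' = normal_imp_subgroup[OF nRM'] and sSM = normal_imp_subgroup[OF nSM]
  have MSM: "M \<subseteq> SM" "S \<subseteq> SM" and MRM: "M \<subseteq> RM" "R \<subseteq> RM"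
    unfolding SM_def RM_def using subset_set_mult[OF sM sS] subset_set_mult[OF sM sR] by auto
  have SMRM: "SM \<subseteq> RM" unfolding SM_def RM_def using SR by (intro mono_set_mult) auto
  have cover: "\<exists>m\<in>M. \<exists>a\<in>A. x = m \<otimes> a" if "x \<in> carrier G" for x
    using that unfolding GMA set_mult_def by blast
  note Mc = subgroup.mem_carrier[OF sM] and Ac = subgroup.mem_carrier[OF A]
  \<comment> \<open>Dedekind's law: a subgroup Y above M equals M (Y \<inter> A).\<close>
  have split: "\<exists>m\<in>M. \<exists>a\<in>Y \<inter> A. x = m \<otimes> a" if Y: "subgroup Y G" "M \<subseteq> Y" and x: "x \<in> Y" for x Y
  proof -
    obtain m a where ma: "m \<in> M" "a \<in> A" "x = m \<otimes> a"
      using cover subgroup.mem_carrier[OF Y(1) x] by blast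
    have "inv m \<otimes> x \<in> Y"
      using Y(2) ma(1) x subgroup.m_closed[OF Y(1)] subgroup.m_inv_closed[OF Y(1)] by (meson subsetD)
    then have "a \<in> Y" using ma Mc Ac by (simp add: group_normalize)
    then show ?thesis using ma by blast
  qed
  have card_Int_A: "card Y * card (M \<inter> A) = card M * card (Y \<inter> A)" if Y: "subgroup Y G" "M \<subseteq> Y" for Y
  proof -
    have sYA: "subgroup (Y \<inter> A) G" using Y A subgroups_Inter_pair by blast
    have "M <#> (Y \<inter> A) = Y"
    proof
      show "M <#> (Y \<inter> A) \<subseteq> Y" using set_mult_subset[OF Y(1,2)] by blast
      show "Y \<subseteq> M <#> (Y \<inter> A)" using split[OF Y] unfolding set_mult_def by blast
    qed
    moreover have "M \<inter> (Y \<inter> A) = M \<inter> A" using Y by blast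
    ultimately show ?thesis using card_set_mult[OF sM sYA] by simp
  qed
  have M0: "card M > 0" by (rule card_subgroup_pos[OF sM fin])
  have sMA: "subgroup (M \<inter> A) G" and sMS: "subgroup (M \<inter> S) G"
    using sM A sS subgroups_Inter_pair by blast+
  have MA0: "card (M \<inter> A) > 0" by (rule card_subgroup_pos[OF sMA fin])
  have MS0: "card (M \<inter> S) > 0" by (rule card_subgroup_pos[OF sMS fin])
  \<comment> \<open>M \<inter> R = M \<inter> S keeps the index of S in R unchanged when both are
    multiplied by M.\<close>
  have cRS: "card RM = card SM * l"
  proof -
    have "card RM * card (M \<inter> S) = card M * (card S * l)"
      using card_set_mult[OF sM sR] l unfolding RM_def RMS by simp
    also have "\<dots> = card SM * card (M \<inter> S) * l"
      using card_set_mult[OF sM sS] unfolding SM_def by simp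
    finally show ?thesis using MS0 by simp
  qed
  have c1: "card (RM \<inter> A) = card (SM \<inter> A) * l"
  proof -
    have "card M * card (RM \<inter> A) = card SM * card (M \<inter> A) * l"
      using card_Int_A[OF sRM' MRM(1)] cRS by (simp add: mult_ac)
    also have "\<dots> = card M * (card (SM \<inter> A) * l)"
      unfolding card_Int_A[OF sSM MSM(1)] by (simp add: mult_ac)
    finally show ?thesis using M0 by simp
  qed
  have sSA: "subgroup (SM \<inter> A) G" using sSM A subgroups_Inter_pair by blast
  have SA0: "card (SM \<inter> A) > 0" by (rule card_subgroup_pos[OF sSA fin])
  have "chief_factor (G\<lparr>carrier := A\<rparr>) (RM \<inter> A) (SM \<inter> A)"
    unfolding chief_factor_def
  proof (intro conjI allI impI)
    show "SM \<inter> A \<lhd> G\<lparr>carrier := A\<rparr>" "RM \<inter> A \<lhd> G\<lparr>carrier := A\<rparr>"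
      using normal_Int_subgroup[OF A] nSM nRM' by auto
    have "l \<noteq> 1" using pl p by (auto simp: prime_nat_iff)
    then have "RM \<inter> A \<noteq> SM \<inter> A" using c1 SA0 by auto
    then show "SM \<inter> A \<subset> RM \<inter> A" using SMRM by blast
    fix U assume "U \<lhd> G\<lparr>carrier := A\<rparr> \<and> SM \<inter> A \<subseteq> U \<and> U \<subseteq> RM \<inter> A"
    then have U: "U \<lhd> G\<lparr>carrier := A\<rparr>" "SM \<inter> A \<subseteq> U" "U \<subseteq> RM \<inter> A" by auto
    have sU: "subgroup U G" using incl_subgroup[OF A normal_imp_subgroup[OF U(1)]] .
    have conjU: "a \<otimes> x \<otimes> inv a \<in> U" if "a \<in> A" "x \<in> U" for a x
      using normal.inv_op_closed2[OF U(1), of a x] that m_inv_consistent[OF A] by simp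
    have sMU: "subgroup (M <#> U) G" by (rule mult_norm_subgroup[OF M sU])
    have MMU: "M \<subseteq> M <#> U" "U \<subseteq> M <#> U" using subset_set_mult[OF sM sU] by auto
    \<comment> \<open>Since G = MA, it is enough that conjugation by A preserves M and U, and that
      elements of M conjugate MU within itself.\<close>
    have nMU: "M <#> U \<lhd> G"
      unfolding normal_inv_iff
    proof (intro conjI ballI sMU)
      fix g x assume g: "g \<in> carrier G" and x: "x \<in> M <#> U"
      obtain m a where ma: "m \<in> M" "a \<in> A" "g = m \<otimes> a" using cover[OF g] by blast
      obtain n u where nu: "n \<in> M" "u \<in> U" "x = n \<otimes> u" using x unfolding set_mult_def by blast
      have c: "m \<in> carrier G" "a \<in> carrier G" "n \<in> carrier G" "u \<in> carrier G"
        using ma nu Mc Ac subgroup.mem_carrier[OF sU] by auto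
      have "a \<otimes> n \<otimes> inv a \<in> M <#> U" using normal.inv_op_closed2[OF M c(2) nu(1)] MMU by blast
      moreover have "a \<otimes> u \<otimes> inv a \<in> M <#> U" using conjU[OF ma(2) nu(2)] MMU by blast
      moreover have "m \<in> M <#> U" "inv m \<in> M <#> U"
        using ma(1) subgroup.m_inv_closed[OF sM ma(1)] MMU by auto
      ultimately have "m \<otimes> ((a \<otimes> n \<otimes> inv a) \<otimes> (a \<otimes> u \<otimes> inv a)) \<otimes> inv m \<in> M <#> U"
        by (meson subgroup.m_closed[OF sMU])
      then show "g \<otimes> x \<otimes> inv g \<in> M <#> U"
        using c by (simp add: ma(3) nu(3) group_normalize)
    qed
    have "(M <#> U) \<inter> R \<lhd> G" by (rule normal_subgroup_intersect[OF nMU R])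
    moreover have "S \<subseteq> M <#> U"
    proof
      fix s assume "s \<in> S"
      then have "s \<in> SM" using MSM by blast
      then obtain m a where "m \<in> M" "a \<in> SM \<inter> A" "s = m \<otimes> a"
        using split[OF sSM MSM(1)] by blast
      then show "s \<in> M <#> U" using U(2) unfolding set_mult_def by blast
    qed
    \<comment> \<open>(MU) \<inter> R is normal in G and lies between S and R, so the minimality of
      R/S applies; in each case U is recovered from it.\<close>
    ultimately consider "(M <#> U) \<inter> R = S" | "(M <#> U) \<inter> R = R"
      using minimal[of "(M <#> U) \<inter> R"] SR by blast
    then show "U = SM \<inter> A \<or> U = RM \<inter> A"
    proof cases
      case 1
      have "U \<subseteq> SM \<inter> A"
      proof
        fix x assume x: "x \<in> U"
        then have "x \<in> RM" "x \<in> A" using U by auto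
        then obtain m r where mr: "m \<in> M" "r \<in> R" "x = m \<otimes> r" unfolding RM_def set_mult_def by blast
        have c: "m \<in> carrier G" "r \<in> carrier G" using mr Mc subgroup.mem_carrier[OF sR] by auto
        have "inv m \<otimes> x \<in> M <#> U"
          using x mr(1) MMU subgroup.m_closed[OF sMU] subgroup.m_inv_closed[OF sM] by (meson subsetD)
        then have "r \<in> S" using mr c 1 by (auto simp: group_normalize)
        then show "x \<in> SM \<inter> A" using mr \<open>x \<in> A\<close> unfolding SM_def set_mult_def by blast
      qed
      then show ?thesis using U by blast
    next
      case 2
      then have "RM \<subseteq> M <#> U"
        unfolding RM_def using MMU by (intro set_mult_subset[OF sMU]) auto
      have "RM \<inter> A \<subseteq> U"
      proof
        fix x assume x: "x \<in> RM \<inter> A"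
        then obtain m u where mu: "m \<in> M" "u \<in> U" "x = m \<otimes> u"
          using \<open>RM \<subseteq> M <#> U\<close> unfolding set_mult_def by blast
        have c: "m \<in> carrier G" "u \<in> carrier G" "u \<in> A"
          using mu U Mc subgroup.mem_carrier[OF sU] by auto
        have "x \<otimes> inv u \<in> A"
          using x c subgroup.m_closed[OF A] subgroup.m_inv_closed[OF A] by (meson IntD2)
        then have "m \<in> A" using mu c by (simp add: group_normalize)
        \<comment> \<open>m lies in M \<inter> A, which is contained in SM \<inter> A \<le>
          U.\<close>
        then have "m \<in> U" using mu MSM U by blast
        then show "x \<in> U" using mu subgroup.m_closed[OF sU] by blast
      qed
      then show ?thesis using U by blast
    qed
  qed
  moreover have "card (RM \<inter> A) div card (SM \<inter> A) = l" using c1 SA0 by simp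
  ultimately have "card (RM \<inter> A) = p * card (SM \<inter> A)"
    using ss pl unfolding p_supersolvable_def by metis
  then have "l = p" using c1 SA0 by simp
  then show "card R = p * card S" using l by simp
qed

end

theorem theorem1p2:
  fixes G :: "('a, 'b) monoid_scheme" and p :: nat and P H :: "'a set"
  assumes "group G" and "finite (carrier G)" and "Factorial_Ring.prime p"
    and "p_solvable p G"
    and "sylow_subgroup G p P"
    and "subgroup H G" and "derived G P \<subseteq> H" and "H \<subseteq> frattini (G\<lparr>carrier := P\<rparr>)"
    and "s_semipermutable H G"
    and "p_supersolvable p (G\<lparr>carrier := normalizer G P\<rparr>)"
  shows "p_supersolvable p G"
proof -
  interpret group G by fact
  obtain M where M: "M \<lhd> G" "\<not> p dvd card M" "M <#>\<^bsub>G\<^esub> P \<lhd> G"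
    using sylow_normal_modulo_coprime_normal[OF assms(2-5,9,7,8)] .
  have "subgroup (normalizer G P) G"
    using assms(5) unfolding sylow_subgroup_def by (blast intro: normalizer_imp_subgroup dest: subgroup.subset)
  then show ?thesis
    using p_supersolvable_normal_mult[OF assms(2,3) M(1,2)]
      frattini_argument[OF assms(2,3,5) M] assms(10) by blast
qed

end
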